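(* For every $\tau\in\mathbb{H}^2$ set $$f(\tau)=\frac{\eta^4(2\tau)\,\eta^8(3\tau)}{\eta^8(\tau)\,\eta^4(6\tau)} .$$ Then the inverse function $\tau=\tau(f)$ yields $l(f)=c(\tau(f))$, and $l(f)$ satisfies the differential equation $$\frac{d^2l}{df^2}+\left\{-\frac{\frac13}{f}+\frac{\frac13}{f-1}+\frac{1}{f-\frac19}\right\}\frac{dl}{df}+\frac{4\left(f-\frac13\right)}{27f^2(f-1)^2\left(f-\frac19\right)}\,l=0 .$$
   Context: $\mathbb{H}^2=\{\tau\in\mathbb{C}\mid \Im\tau>0\}$; $\eta(\tau)=e^{2\pi i\tau/24}\prod_{n\ge1}(1-e^{2\pi i n\tau})$ is the Dedekind eta function and $\eta^k(m\tau)=(\eta(m\tau))^k$. The cubic theta function $c$ is $c(\tau)=\sum_{m,n\in\mathbb{Z}}q^{(n+\frac13)^2+(n+\frac13)(m+\frac13)+(m+\frac13)^2}$, where $q^r=\exp(2\pi i r\tau)$ for rational $r$. The inverse function $\tau=\tau(f)$ means any local holomorphic inverse of $\tau\mapsto f(\tau)$; thus $l$ is regarded locally as a function of the variable $f$. *)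

theory Defs
  imports "HOL-Analysis.Analysis"
begin

definition upper_half_plane :: "complex set" where
  "upper_half_plane = {\<tau>. Im \<tau> > 0}"

text \<open>
  Infinite products in the library are indexed from \<open>0\<close>, hence the shift
  to \<open>Suc n\<close>.
\<close>
definition dedekind_eta :: "complex \<Rightarrow> complex" where
  "dedekind_eta \<tau> =
     exp (2 * of_real pi * \<i> * \<tau> / 24) *
     (\<Prod>n. 1 - exp (2 * of_real pi * \<i> * of_nat (Suc n) * \<tau>))"

text \<open>
  The rational power \<open>q\<^sup>r\<close> depends on \<open>\<tau>\<close> and not only on
  \<open>q = exp (2 \<pi> \<i> \<tau>)\<close>; no branch of a complex power is involved.
\<close>
definition q_power :: "complex \<Rightarrow> rat \<Rightarrow> complex" where
  "q_power \<tau> r = exp (2 * of_real pi * \<i> * of_rat r * \<tau>)"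

text \<open>The sum converges absolutely on the upper half plane.\<close>
definition cubic_theta_c :: "complex \<Rightarrow> complex" where
  "cubic_theta_c \<tau> =
     (\<Sum>\<^sub>\<infinity>(m, n)\<in>(UNIV :: (int \<times> int) set).
        q_power \<tau> ((of_int n + 1/3)\<^sup>2 + (of_int n + 1/3) * (of_int m + 1/3)
                    + (of_int m + 1/3)\<^sup>2))"

definition eta_quotient :: "complex \<Rightarrow> complex" where
  "eta_quotient \<tau> =
     (dedekind_eta (2 * \<tau>) ^ 4 * dedekind_eta (3 * \<tau>) ^ 8) /
     (dedekind_eta \<tau> ^ 8 * dedekind_eta (6 * \<tau>) ^ 4)"

text \<open>
  A right inverse suffices: it is injective, hence by the open mapping theorem its image
  is open, and there it is also a left inverse of the given function.
\<close>
definition local_holomorphic_inverse ::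
  "(complex \<Rightarrow> complex) \<Rightarrow> complex set \<Rightarrow> complex set \<Rightarrow> (complex \<Rightarrow> complex) \<Rightarrow> bool" where
  "local_holomorphic_inverse f D V T \<longleftrightarrow>
     open V \<and> T holomorphic_on V \<and> T ` V \<subseteq> D \<and> (\<forall>w\<in>V. f (T w) = w)"

end

theory Submission
  imports Defs "HOL-Complex_Analysis.Complex_Analysis"
begin

text \<open>
  Let \<open>s(z)\<close>, \<open>d(z)\<close>, \<open>e(z)\<close> be the successive logarithmic derivatives in \<open>z\<close> of the odd
  Jacobi theta function \<open>\<theta>(z, \<tau>)\<close>. Jacobi's triple product turns the eta quotient into
  \<open>f = \<theta>(1/3)\<^sup>4 / (9 \<theta>(1/6)\<^sup>4)\<close> and gives \<open>c\<^sup>3 \<theta>'(0) = const \<cdot> \<theta>(1/3)\<^sup>9\<close>.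
  The addition theorems for \<open>s\<close> and \<open>d\<close>, which follow from Liouville's theorem in \<open>z\<close>, make all
  logarithmic derivatives at the points of order 6 polynomials in \<open>s(1/6)\<close>, \<open>s(1/3)\<close>
  and \<open>d(1/3)\<close>, and with \<open>g = s(1/6) - 2 s(1/3)\<close> one finds \<open>s(1/6) = 3 f g\<close>. The heat equation
  expresses derivatives in \<open>\<tau>\<close> by derivatives in \<open>z\<close>; with \<open>D = (2 \<pi> \<i>)\<^sup>-\<^sup>1 d/d\<tau>\<close> it yields
  \<open>D f = - 3/2 f (f - 1) (9 f - 1) g\<^sup>2\<close>, \<open>D c = c d(1/3)\<close> and a Riccati equation
  for \<open>d(1/3) / g\<^sup>2\<close> with coefficients rational in \<open>f\<close>, which is the stated equation for \<open>c\<close>.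
  No modular transformation in \<open>\<tau>\<close> is used.
\<close>

section \<open>The theta series\<close>

text \<open>Each derivative in \<open>\<tau>\<close> raises the order of a logarithmic derivative by
  two, so the tower has to close somewhere. It closes at 1/6, 1/3 and 1/2: up to z -> 1 - z these
  points are stable under the sums 1/6 + 1/6, 1/6 + 1/3 and 1/3 + 1/3, and odd orders vanish at 1/2.
  The addition theorem has one inhomogeneous term,
  \<open>theta 3 0 \<tau> / theta 1 0 \<tau>\<close>, which is 6 D log eta; one relation determines
  it and eliminates it from the others. It also cancels in D log c, because c is a multiple of
  theta(1/3)^3 / eta. A linear second order equation for c in the variable f amounts to a first
  order Riccati equation for the logarithmic derivative of c. Here g acts as the unit of weight:
  both d(1/3) and D f are measured in g^2, so g disappears once f is the variable. That g, f and 9 f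
  - 1 never vanish follows by expressing them through values of theta off the period
  lattice.\<close>

definition shift_half :: "int \<Rightarrow> complex" where
  "shift_half n = of_int n + 1/2"

text \<open>
  The shift by \<open>1/2\<close> in \<open>z + 1/2\<close> produces the sign \<open>(-1)\<^sup>n\<close> (and a factor \<open>\<i>\<close>);
  \<open>k\<close> counts applications of \<open>(2 \<pi> \<i>)\<^sup>-\<^sup>1 d/dz\<close>.
\<close>
definition theta_term :: "nat \<Rightarrow> complex \<Rightarrow> complex \<Rightarrow> int \<Rightarrow> complex" where
  "theta_term k z \<tau> n = shift_half n ^ k *
     exp (of_real pi * \<i> * \<tau> * shift_half n ^ 2 + 2 * of_real pi * \<i> * shift_half n * (z + 1/2))"

text \<open>\<open>theta 0\<close> is the theta function with characteristic (1/2, 1/2), that is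
  theta_11 = - theta_1; hence the minus signs in its special values.\<close>

definition theta :: "nat \<Rightarrow> complex \<Rightarrow> complex \<Rightarrow> complex" where
  "theta k z \<tau> = (\<Sum>\<^sub>\<infinity>n. theta_term k z \<tau> n)"

section \<open>Convergence of the theta series\<close>

lemma norm_shift_half: "norm (shift_half n) = \<bar>of_int n + 1/2\<bar>"
proof -
  have "shift_half n = of_real (of_int n + 1/2)" by (simp add: shift_half_def)
  then show ?thesis by (metis norm_of_real)
qed

lemma Re_shift_half [simp]: "Re (shift_half n) = of_int n + 1/2"
  and Im_shift_half [simp]: "Im (shift_half n) = 0"
  by (simp_all add: shift_half_def)

lemma norm_theta_term:
  "norm (theta_term k z \<tau> n) = \<bar>of_int n + 1/2\<bar> ^ k *
     exp (- pi * Im \<tau> * (of_int n + 1/2)\<^sup>2 - 2 * pi * (of_int n + 1/2) * Im z)"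
  by (simp add: theta_term_def norm_mult norm_power norm_shift_half power2_eq_square algebra_simps)

lemma summable_on_exp_abs_int: "(\<lambda>n::int. exp (- \<bar>real_of_int n\<bar>)) summable_on UNIV"
proof -
  have *: "summable (\<lambda>n. exp (- real n))"
    using summable_geometric[of "exp (-1::real)"] by (simp flip: exp_of_nat_mult)
  have nat: "(\<lambda>n. exp (- real n)) summable_on UNIV"
    using * by (intro norm_summable_imp_summable_on) simp
  have "(\<lambda>n::int. exp (- \<bar>real_of_int n\<bar>)) summable_on range int"
    by (subst summable_on_reindex) (use nat in \<open>auto simp: o_def\<close>)
  moreover have "(\<lambda>n::int. exp (- \<bar>real_of_int n\<bar>)) summable_on range (\<lambda>n. - int n)"
    by (subst summable_on_reindex) (use nat in \<open>auto simp: o_def inj_on_def\<close>)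
  ultimately have "(\<lambda>n::int. exp (- \<bar>real_of_int n\<bar>)) summable_on (range int \<union> range (\<lambda>n. - int n))"
    by (rule summable_on_union)
  also have "range int \<union> range (\<lambda>n. - int n) = UNIV"
  proof -
    have "n \<in> range int \<union> range (\<lambda>n. - int n)" for n :: int
      by (cases n rule: int_cases2) auto
    then show ?thesis by blast
  qed
  finally show ?thesis .
qed

lemma power_le_fact_exp:
  fixes x :: real
  assumes "x \<ge> 0"
  shows "x ^ k \<le> fact k * exp x"
proof -
  have "(\<lambda>n. x ^ n /\<^sub>R fact n) sums exp x" by (rule exp_converges)
  then have "(\<Sum>n\<in>{k}. x ^ n /\<^sub>R fact n) \<le> exp x"
    using assms by (intro sum_le_suminf[of _ "{k}", THEN order_trans]) (auto simp: sums_iff)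
  then show ?thesis by (simp add: field_simps)
qed

lemma summable_theta_majorant:
  fixes \<delta> R :: real
  assumes "\<delta> > 0" "R \<ge> 0"
  shows "(\<lambda>n::int. \<bar>of_int n + 1/2\<bar> ^ k * exp (- pi * \<delta> * (of_int n + 1/2)\<^sup>2 + 2 * pi * \<bar>of_int n + 1/2\<bar> * R))
           summable_on UNIV"
proof -
  \<comment> \<open>Of the 2 in \<open>c\<close>, one unit pays for
    \<open>h ^ k \<le> fact k * exp h\<close> and the other leaves the decaying factor
    \<open>exp (- h)\<close>. Completing the square bounds \<open>c * h - a * h\<^sup>2\<close>
    independently of \<open>h\<close>.\<close>
  define c a where "c = 2 * pi * R + 2" and "a = pi * \<delta>"
  define C where "C = fact k * exp (c\<^sup>2 / (4 * a) + 1/2)"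
  have "a > 0" using assms by (simp add: a_def)
  have bound: "\<bar>of_int n + 1/2\<bar> ^ k * exp (- pi * \<delta> * (of_int n + 1/2)\<^sup>2 + 2 * pi * \<bar>of_int n + 1/2\<bar> * R)
      \<le> C * exp (- \<bar>real_of_int n\<bar>)" (is "?l \<le> _") for n :: int
  proof -
    define h where "h = \<bar>real_of_int n + 1/2\<bar>"
    have "0 \<le> (c - 2 * a * h)\<^sup>2" by simp
    then have "4 * a * (c * h - a * h\<^sup>2) \<le> c\<^sup>2" by (simp add: power2_eq_square algebra_simps)
    then have *: "c * h - a * h\<^sup>2 \<le> c\<^sup>2 / (4 * a)" using \<open>a > 0\<close> by (simp add: field_simps)
    have n: "\<bar>real_of_int n\<bar> \<le> h + 1/2" unfolding h_def by arith
    have "?l = h ^ k * exp (- a * h\<^sup>2 + 2 * pi * h * R)"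
      by (simp add: h_def a_def)
    also have "\<dots> \<le> (fact k * exp h) * exp (- a * h\<^sup>2 + 2 * pi * h * R)"
      by (intro mult_right_mono power_le_fact_exp) (auto simp: h_def)
    also have "\<dots> = fact k * exp (c * h - a * h\<^sup>2 - h)"
      by (simp add: c_def mult.assoc algebra_simps flip: exp_add)
    also have "\<dots> \<le> fact k * exp (c\<^sup>2 / (4 * a) + 1/2 - \<bar>real_of_int n\<bar>)"
      using * n by (intro mult_left_mono) auto
    also have "\<dots> = C * exp (- \<bar>real_of_int n\<bar>)"
      by (simp add: C_def mult.assoc flip: exp_add)
    finally show ?thesis .
  qed
  have "(\<lambda>n::int. C * exp (- \<bar>real_of_int n\<bar>)) summable_on UNIV"
    by (intro summable_on_cmult_right summable_on_exp_abs_int)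
  then have "(\<lambda>n::int. norm (\<bar>of_int n + 1/2\<bar> ^ k * exp (- pi * \<delta> * (of_int n + 1/2)\<^sup>2 + 2 * pi * \<bar>of_int n + 1/2\<bar> * R)))
           summable_on UNIV"
    by (rule Infinite_Sum.abs_summable_on_comparison_test') (use bound in \<open>auto simp: abs_mult\<close>)
  then show ?thesis by (rule Infinite_Sum.abs_summable_summable)
qed

text \<open>The majorant is uniform on a strip in \<open>z\<close> and on a half plane in
  \<open>\<tau>\<close>, so that it serves termwise differentiation in either variable.\<close>

lemma norm_theta_term_le:
  assumes "Im \<tau> \<ge> \<delta>" "\<bar>Im z\<bar> \<le> R"
  shows "norm (theta_term k z \<tau> n) \<le>
    \<bar>of_int n + 1/2\<bar> ^ k * exp (- pi * \<delta> * (of_int n + 1/2)\<^sup>2 + 2 * pi * \<bar>of_int n + 1/2\<bar> * R)"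
proof -
  define h where "h = real_of_int n + 1/2"
  have "pi * \<delta> * h\<^sup>2 \<le> pi * Im \<tau> * h\<^sup>2"
    using assms by (intro mult_right_mono mult_left_mono) auto
  moreover have "- (2 * pi * h * Im z) \<le> 2 * pi * \<bar>h\<bar> * R"
  proof -
    have "- (h * Im z) \<le> \<bar>h * Im z\<bar>" by simp
    also have "\<dots> \<le> \<bar>h\<bar> * R" unfolding abs_mult using assms by (intro mult_left_mono) auto
    finally have "2 * pi * (- (h * Im z)) \<le> 2 * pi * (\<bar>h\<bar> * R)" by (intro mult_left_mono) auto
    then show ?thesis by (simp add: algebra_simps)
  qed
  ultimately have "- pi * Im \<tau> * h\<^sup>2 - 2 * pi * h * Im z \<le> - pi * \<delta> * h\<^sup>2 + 2 * pi * \<bar>h\<bar> * R"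
    by linarith
  then show ?thesis
    unfolding norm_theta_term h_def[symmetric] by (intro mult_left_mono) auto
qed

lemma abs_summable_theta_term:
  assumes "Im \<tau> > 0"
  shows "(\<lambda>n. norm (theta_term k z \<tau> n)) summable_on UNIV"
proof (rule Infinite_Sum.abs_summable_on_comparison_test')
  show "(\<lambda>n::int. \<bar>of_int n + 1/2\<bar> ^ k * exp (- pi * Im \<tau> * (of_int n + 1/2)\<^sup>2 + 2 * pi * \<bar>of_int n + 1/2\<bar> * \<bar>Im z\<bar>))
           summable_on UNIV"
    using assms by (intro summable_theta_majorant) simp_all
qed (intro norm_theta_term_le order_refl)

lemma has_sum_theta:
  assumes "Im \<tau> > 0"
  shows "(theta_term k z \<tau> has_sum theta k z \<tau>) UNIV"
  unfolding theta_def
  by (rule has_sum_infsum[OF Infinite_Sum.abs_summable_summable[OF abs_summable_theta_term[OF assms]]])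

section \<open>Termwise differentiation\<close>

lemma theta_term_deriv_z:
  "((\<lambda>z. theta_term k z \<tau> n) has_field_derivative 2 * of_real pi * \<i> * theta_term (Suc k) z \<tau> n) (at z)"
  unfolding theta_term_def by (rule derivative_eq_intros refl)+ (simp add: mult_ac)

lemma theta_term_deriv_tau:
  "((\<lambda>\<tau>. theta_term k z \<tau> n) has_field_derivative of_real pi * \<i> * theta_term (k + 2) z \<tau> n) (at \<tau>)"
  unfolding theta_term_def by (rule derivative_eq_intros refl)+ (simp add: power2_eq_square mult_ac)

lemma has_sum_diff_complex:
  fixes f g :: "'a \<Rightarrow> complex"
  assumes "(f has_sum a) A" "(g has_sum b) A"
  shows "((\<lambda>x. f x - g x) has_sum (a - b)) A"
  using has_sum_add[OF assms(1) has_sum_uminusI[OF assms(2)]] by simp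

text \<open>By Weierstrass' theorem on locally uniform limits, a majorant of the terms themselves
  suffices. The derived series only has to converge at the point \<open>z\<close>, where uniqueness
  of limits identifies its sum with the derivative.\<close>

lemma has_field_derivative_infsum_uniform:
  fixes f f' :: "'a \<Rightarrow> complex \<Rightarrow> complex"
  assumes r: "r > 0" and M: "M summable_on UNIV"
    and bound: "\<And>n w. w \<in> cball z r \<Longrightarrow> norm (f n w) \<le> M n"
    and deriv: "\<And>n w. (f n has_field_derivative f' n w) (at w)"
    and sum: "((\<lambda>n. f' n z) has_sum D) UNIV"
  shows "((\<lambda>w. \<Sum>\<^sub>\<infinity>n. f n w) has_field_derivative D) (at z)"
proof -
  let ?F = "finite_subsets_at_top (UNIV :: 'a set)"
  have ulim: "uniform_limit (cball z r) (\<lambda>X w. \<Sum>n\<in>X. f n w) (\<lambda>w. \<Sum>\<^sub>\<infinity>n. f n w) ?F"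
    by (rule Weierstrass_m_test_general[OF bound M]) auto
  have cont: "continuous_on (cball z r) (\<lambda>w. \<Sum>n\<in>X. f n w) \<and>
     (\<forall>w\<in>ball z r. ((\<lambda>w. \<Sum>n\<in>X. f n w) has_field_derivative (\<Sum>n\<in>X. f' n w)) (at w))" for X
    by (intro conjI ballI continuous_on_sum DERIV_sum deriv continuous_at_imp_continuous_on DERIV_isCont[OF deriv])
  obtain g' where g': "\<And>w. w \<in> ball z r \<Longrightarrow>
      ((\<lambda>w. \<Sum>\<^sub>\<infinity>n. f n w) has_field_derivative g' w) (at w) \<and> ((\<lambda>X. \<Sum>n\<in>X. f' n w) \<longlongrightarrow> g' w) ?F"
    by (rule has_complex_derivative_uniform_limit[OF always_eventually ulim _ r]) (use cont in auto)
  have "g' z = D"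
    using g'[of z] sum r tendsto_unique[of ?F] by (auto simp: has_sum_def)
  with g'[of z] r show ?thesis by auto
qed

lemma DERIV_theta_z:
  assumes "Im \<tau> > 0"
  shows "((\<lambda>z. theta k z \<tau>) has_field_derivative 2 * of_real pi * \<i> * theta (Suc k) z \<tau>) (at z)"
  unfolding theta_def[of k]
proof (rule has_field_derivative_infsum_uniform[where r = 1 and f' = "\<lambda>n z. 2 * of_real pi * \<i> * theta_term (Suc k) z \<tau> n"])
  show "norm (theta_term k w \<tau> n) \<le> \<bar>of_int n + 1/2\<bar> ^ k *
     exp (- pi * Im \<tau> * (of_int n + 1/2)\<^sup>2 + 2 * pi * \<bar>of_int n + 1/2\<bar> * (\<bar>Im z\<bar> + 1))"
    if "w \<in> cball z 1" for n w
  proof (rule norm_theta_term_le)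
    have "\<bar>Im (z - w)\<bar> \<le> norm (z - w)" by (rule abs_Im_le_cmod)
    with that show "\<bar>Im w\<bar> \<le> \<bar>Im z\<bar> + 1" by (simp add: dist_norm)
  qed simp
  show "(\<lambda>n::int. \<bar>of_int n + 1/2\<bar> ^ k *
     exp (- pi * Im \<tau> * (of_int n + 1/2)\<^sup>2 + 2 * pi * \<bar>of_int n + 1/2\<bar> * (\<bar>Im z\<bar> + 1))) summable_on UNIV"
    using assms by (intro summable_theta_majorant) auto
qed (use assms in \<open>simp_all only: theta_term_deriv_z has_sum_cmult_right has_sum_theta zero_less_one\<close>)

text \<open>The heat equation: one derivative in \<open>\<tau>\<close> brings down
  \<open>shift_half n ^ 2\<close>, as two derivatives in \<open>z\<close> do, up to a
  constant.\<close>

lemma DERIV_theta_tau: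
  assumes "Im \<tau> > 0"
  shows "((\<lambda>\<tau>. theta k z \<tau>) has_field_derivative of_real pi * \<i> * theta (k + 2) z \<tau>) (at \<tau>)"
  unfolding theta_def[of k]
proof (rule has_field_derivative_infsum_uniform[where r = "Im \<tau> / 2" and f' = "\<lambda>n \<tau>. of_real pi * \<i> * theta_term (k + 2) z \<tau> n"])
  show "norm (theta_term k z w n) \<le> \<bar>of_int n + 1/2\<bar> ^ k *
     exp (- pi * (Im \<tau> / 2) * (of_int n + 1/2)\<^sup>2 + 2 * pi * \<bar>of_int n + 1/2\<bar> * \<bar>Im z\<bar>)"
    if "w \<in> cball \<tau> (Im \<tau> / 2)" for n w
  proof (rule norm_theta_term_le)
    have "\<bar>Im (\<tau> - w)\<bar> \<le> norm (\<tau> - w)" by (rule abs_Im_le_cmod)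
    with that show "Im \<tau> / 2 \<le> Im w" by (simp add: dist_norm)
  qed simp
  show "(\<lambda>n::int. \<bar>of_int n + 1/2\<bar> ^ k *
     exp (- pi * (Im \<tau> / 2) * (of_int n + 1/2)\<^sup>2 + 2 * pi * \<bar>of_int n + 1/2\<bar> * \<bar>Im z\<bar>)) summable_on UNIV"
    using assms by (intro summable_theta_majorant) auto
qed (use assms in \<open>simp_all only: theta_term_deriv_tau has_sum_cmult_right has_sum_theta half_gt_zero\<close>)

section \<open>Parity and quasi-periodicity\<close>

lemma theta_minus: 
  assumes "Im \<tau> > 0"
  shows "theta k (- z) \<tau> = - ((-1) ^ k * theta k z \<tau>)"
proof -
  \<comment> \<open>The reflection of the index negates \<open>shift_half n\<close>. The
    characteristic 1/2 in \<open>z + 1/2\<close> then leaves exp (- 2 pi i (n + 1/2)) = -1, which is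
    what makes \<open>theta 0\<close> odd.\<close>
  have "theta_term k (-z) \<tau> (-1-n) = - ((-1) ^ k * theta_term k z \<tau> n)" for n
  proof -
    have h: "shift_half (-1-n) = - shift_half n" by (simp add: shift_half_def)
    have "exp (of_real pi * \<i> * \<tau> * shift_half n ^ 2 + 2 * of_real pi * \<i> * (- shift_half n) * (-z + 1/2))
      = exp (of_real pi * \<i> * \<tau> * shift_half n ^ 2 + 2 * of_real pi * \<i> * shift_half n * (z + 1/2)
           + \<i> * (of_int (- 2 * n - 1) * of_real pi))"
      by (simp add: shift_half_def algebra_simps)
    also have "\<dots> = exp (of_real pi * \<i> * \<tau> * shift_half n ^ 2 + 2 * of_real pi * \<i> * shift_half n * (z + 1/2))
       * exp (\<i> * (of_int (- 2 * n - 1) * of_real pi))" by (rule exp_add)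
    also have "exp (\<i> * (of_int (- 2 * n - 1) * of_real pi)) = -1"
    proof -
      have "\<i> * (of_int (- 2 * n - 1) * of_real pi) = of_int (- n - 1) * (of_real (2 * pi) * \<i>) + of_real pi * \<i>"
        by (simp add: algebra_simps)
      moreover have "exp (of_int (- n - 1) * (of_real (2 * pi) * \<i>)) = 1"
        using exp_integer_2pi[of "of_int (- n - 1)"] by (simp add: mult_ac)
      ultimately show ?thesis by (simp only: exp_add exp_pi_i mult_1)
    qed
    finally show ?thesis by (simp add: theta_term_def h power_minus[of "shift_half n"])
  qed
  then have "((\<lambda>n. - ((-1) ^ k * theta_term k z \<tau> n)) has_sum theta k (-z) \<tau>) UNIV"
    using has_sum_theta[OF assms, of k "-z"]
    by (subst has_sum_reindex_bij_witness[where T = UNIV and j = "\<lambda>n. -1-n" and i = "\<lambda>n. -1-n" and h = "theta_term k (-z) \<tau>"]) auto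
  moreover have "((\<lambda>n. - ((-1) ^ k * theta_term k z \<tau> n)) has_sum - ((-1) ^ k * theta k z \<tau>)) UNIV"
    by (intro has_sum_uminusI has_sum_cmult_right has_sum_theta assms)
  ultimately show ?thesis by (rule has_sum_unique)
qed

lemma theta_plus_1: "theta k (z + 1) \<tau> = - theta k z \<tau>"
proof -
  have "theta_term k (z + 1) \<tau> n = - theta_term k z \<tau> n" for n
  proof -
    have "exp (of_real pi * \<i> * \<tau> * shift_half n ^ 2 + 2 * of_real pi * \<i> * shift_half n * (z + 1 + 1/2))
      = exp (of_real pi * \<i> * \<tau> * shift_half n ^ 2 + 2 * of_real pi * \<i> * shift_half n * (z + 1/2)
           + (of_real pi * \<i> + of_int n * (of_real (2 * pi) * \<i>)))"
      by (simp add: shift_half_def algebra_simps)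
    moreover have "exp (of_int n * (of_real (2 * pi) * \<i>)) = 1"
      using exp_integer_2pi[of "of_int n"] by (simp add: mult_ac)
    ultimately show ?thesis
      by (simp only: theta_term_def exp_add[of _ "of_real pi * \<i> + _"] exp_add[of "of_real pi * \<i>"] exp_pi_i) simp
  qed
  then show ?thesis by (simp add: theta_def infsum_uminus)
qed

definition theta_multiplier :: "complex \<Rightarrow> complex \<Rightarrow> complex" where
  "theta_multiplier z \<tau> = - exp (- of_real pi * \<i> * \<tau> - 2 * of_real pi * \<i> * z)"

lemma theta_multiplier_nonzero [simp]: "theta_multiplier z \<tau> \<noteq> 0"
  by (simp add: theta_multiplier_def)

lemma theta_term_plus_tau:
  "theta_term k (z + \<tau>) \<tau> n =
     theta_multiplier z \<tau> * ((shift_half (n + 1) - 1) ^ k * theta_term 0 z \<tau> (n + 1))"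
proof -
  have "of_real pi * \<i> * \<tau> * shift_half n ^ 2 + 2 * of_real pi * \<i> * shift_half n * (z + \<tau> + 1/2)
    = (- of_real pi * \<i> * \<tau> - 2 * of_real pi * \<i> * z) - of_real pi * \<i> + (of_real pi * \<i> * \<tau> * shift_half (n+1) ^ 2
       + 2 * of_real pi * \<i> * shift_half (n+1) * (z + 1/2))"
    by (simp add: shift_half_def power2_eq_square algebra_simps)
  moreover have "shift_half n = shift_half (n + 1) - 1" by (simp add: shift_half_def)
  ultimately show ?thesis
    by (simp only: theta_term_def exp_add[of "_ - of_real pi * \<i>"] exp_diff[of _ "of_real pi * \<i>"] theta_multiplier_def exp_pi_i) simp
qed

text \<open>Completing the square turns the shift by \<open>\<tau>\<close> into n -> n + 1, and
  \<open>shift_half n ^ k\<close> into \<open>(shift_half n - 1) ^ k\<close>; expanding this power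
  mixes in the lower orders. Only special combinations, such as theta 2 * theta 0 - theta 1 ^ 2, are
  multiplied by a plain factor.\<close>

lemma theta_plus_tau:
  assumes "Im \<tau> > 0"
  shows "theta 0 (z + \<tau>) \<tau> = theta_multiplier z \<tau> * theta 0 z \<tau>"
    and "theta 1 (z + \<tau>) \<tau> = theta_multiplier z \<tau> * (theta 1 z \<tau> - theta 0 z \<tau>)"
    and "theta 2 (z + \<tau>) \<tau> = theta_multiplier z \<tau> * (theta 2 z \<tau> - 2 * theta 1 z \<tau> + theta 0 z \<tau>)"
proof -
  have *: "theta k (z + \<tau>) \<tau> = theta_multiplier z \<tau> * S"
    if "((\<lambda>n. (shift_half n - 1) ^ k * theta_term 0 z \<tau> n) has_sum S) UNIV" for k S
  proof -
    have "((\<lambda>n. theta_multiplier z \<tau> * ((shift_half n - 1) ^ k * theta_term 0 z \<tau> n)) has_sum theta_multiplier z \<tau> * S) UNIV"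
      using that by (rule has_sum_cmult_right)
    then have "(theta_term k (z + \<tau>) \<tau> has_sum theta_multiplier z \<tau> * S) UNIV"
      by (subst has_sum_reindex_bij_witness[where T = UNIV and j = "\<lambda>n. n + 1" and i = "\<lambda>n. n - 1"
         and h = "\<lambda>n. theta_multiplier z \<tau> * ((shift_half n - 1) ^ k * theta_term 0 z \<tau> n)"])
         (auto simp: theta_term_plus_tau)
    with has_sum_theta[OF assms] show ?thesis using has_sum_unique by blast
  qed
  note h = has_sum_theta[OF assms, where z = z]
  have t1: "shift_half n * theta_term 0 z \<tau> n = theta_term 1 z \<tau> n" for n by (simp add: theta_term_def)
  have t2: "shift_half n ^ 2 * theta_term 0 z \<tau> n = theta_term 2 z \<tau> n" for n by (simp add: theta_term_def)
  show "theta 0 (z + \<tau>) \<tau> = theta_multiplier z \<tau> * theta 0 z \<tau>"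
    using h[of 0] by (intro *) simp
  show "theta 1 (z + \<tau>) \<tau> = theta_multiplier z \<tau> * (theta 1 z \<tau> - theta 0 z \<tau>)"
  proof (rule *)
    have "((\<lambda>n. theta_term 1 z \<tau> n - theta_term 0 z \<tau> n) has_sum (theta 1 z \<tau> - theta 0 z \<tau>)) UNIV"
      by (intro has_sum_diff_complex h)
    then show "((\<lambda>n. (shift_half n - 1) ^ 1 * theta_term 0 z \<tau> n) has_sum (theta 1 z \<tau> - theta 0 z \<tau>)) UNIV"
      by (simp add: algebra_simps t1)
  qed
  show "theta 2 (z + \<tau>) \<tau> = theta_multiplier z \<tau> * (theta 2 z \<tau> - 2 * theta 1 z \<tau> + theta 0 z \<tau>)"
  proof (rule *)
    have "((\<lambda>n. theta_term 2 z \<tau> n - 2 * theta_term 1 z \<tau> n + theta_term 0 z \<tau> n) has_sum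
       (theta 2 z \<tau> - 2 * theta 1 z \<tau> + theta 0 z \<tau>)) UNIV"
      by (intro has_sum_diff_complex has_sum_add has_sum_cmult_right h)
    moreover have "(shift_half n - 1) ^ 2 * theta_term 0 z \<tau> n = 
       theta_term 2 z \<tau> n - 2 * theta_term 1 z \<tau> n + theta_term 0 z \<tau> n" for n
      unfolding t1[symmetric] t2[symmetric] by algebra
    ultimately show "((\<lambda>n. (shift_half n - 1) ^ 2 * theta_term 0 z \<tau> n) has_sum
       (theta 2 z \<tau> - 2 * theta 1 z \<tau> + theta 0 z \<tau>)) UNIV" by simp
  qed
qed

section \<open>Jacobi's triple product\<close>

text \<open>Tannery's theorem, the dominated convergence theorem for series.\<close>

lemma tendsto_has_sum_dominated:
  fixes f :: "nat \<Rightarrow> 'a \<Rightarrow> complex"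
  assumes sum: "\<And>n. (f n has_sum S n) UNIV" and bound: "\<And>n x. norm (f n x) \<le> M x"
    and M: "M summable_on UNIV" and lim: "\<And>x. (\<lambda>n. f n x) \<longlonglongrightarrow> g x"
    and g: "(g has_sum L) UNIV"
  shows "S \<longlonglongrightarrow> L"
proof (rule swap_uniform_limit')
  show "uniform_limit UNIV (\<lambda>X n. \<Sum>x\<in>X. f n x) S (finite_subsets_at_top UNIV)"
    by (rule Weierstrass_m_test_general'[OF bound sum M])
  show "\<forall>\<^sub>F X in finite_subsets_at_top UNIV. (\<lambda>n. \<Sum>x\<in>X. f n x) \<longlonglongrightarrow> (\<Sum>x\<in>X. g x)"
    by (intro always_eventually allI tendsto_sum lim)
  show "((\<lambda>X. \<Sum>x\<in>X. g x) \<longlongrightarrow> L) (finite_subsets_at_top UNIV)"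
    using g by (simp add: has_sum_def)
qed auto

section \<open>Infinite q-Pochhammer products (y q; q)\<close>

definition qprod :: "complex \<Rightarrow> complex \<Rightarrow> complex" where
  "qprod y q = (\<Prod>n. 1 - y * q ^ Suc n)"

lemma convergent_prod_qprod:
  fixes y q :: complex
  assumes "norm q < 1"
  shows "convergent_prod (\<lambda>n. 1 - y * q ^ Suc n)"
proof -
  have "summable (\<lambda>n. norm (y * q) * norm q ^ n)"
    using assms by (intro summable_mult summable_geometric) auto
  then have "summable (\<lambda>n. norm ((1 - y * q ^ Suc n) - 1))"
    by (simp add: norm_mult norm_power mult.assoc)
  then show ?thesis
    by (intro abs_convergent_prod_imp_convergent_prod summable_imp_abs_convergent_prod)
qed

lemma qprod_LIMSEQ:
  assumes "norm q < 1"
  shows "(\<lambda>N. \<Prod>n<N. 1 - y * q ^ Suc n) \<longlonglongrightarrow> qprod y q"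
  using convergent_prod_LIMSEQ[OF convergent_prod_qprod[OF assms, of y]]
  unfolding qprod_def lessThan_Suc_atMost[symmetric] by (rule LIMSEQ_imp_Suc)

lemma qprod_nonzero:
  assumes "norm q < 1" "\<And>n. y * q ^ Suc n \<noteq> 1"
  shows "qprod y q \<noteq> 0"
  unfolding qprod_def by (rule prodinf_nonzero[OF convergent_prod_qprod[OF assms(1)]]) (use assms(2) in \<open>metis eq_iff_diff_eq_0\<close>)

lemma power_neq_1:
  fixes q :: complex
  assumes "norm q < 1" shows "q ^ Suc n \<noteq> 1"
proof
  assume "q ^ Suc n = 1"
  then have "norm q ^ Suc n = 1" by (metis norm_one norm_power)
  moreover have "norm q ^ Suc n \<le> norm q" using assms by (simp add: mult_left_le power_le_one)
  ultimately show False using assms by simp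
qed

lemma qprod_1_nonzero: "norm q < 1 \<Longrightarrow> qprod 1 q \<noteq> 0"
  by (rule qprod_nonzero) (auto simp: power_neq_1 simp del: power_Suc)

text \<open>For the derivative of theta at z = 0: the product formula is used there in the limit
  \<open>y\<close> -> 1.\<close>

lemma continuous_on_qprod:
  assumes "norm q < 1"
  shows "continuous_on (cball 0 r) (\<lambda>y. qprod y q)"
proof -
  have "uniformly_convergent_on (cball 0 r) (\<lambda>N y. \<Prod>n<N. 1 - y * q ^ Suc n)"
  proof (rule uniformly_convergent_on_prod')
    show "uniformly_convergent_on (cball 0 r) (\<lambda>N y. \<Sum>n<N. norm (1 - y * q ^ Suc n - 1))"
    proof (rule Weierstrass_m_test')
      show "summable (\<lambda>n. r * norm q * norm q ^ n)"
        using assms by (intro summable_mult summable_geometric) auto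
      show "norm (norm (1 - y * q ^ Suc n - 1)) \<le> r * norm q * norm q ^ n" if "y \<in> cball 0 r" for y n
        using that by (auto simp: norm_mult norm_power mult.assoc intro!: mult_right_mono)
    qed
  qed (auto intro!: continuous_intros)
  then obtain l where l: "uniform_limit (cball 0 r) (\<lambda>N y. \<Prod>n<N. 1 - y * q ^ Suc n) l sequentially"
    by (auto simp: uniformly_convergent_on_def)
  have "continuous_on (cball 0 r) l"
    by (rule uniform_limit_theorem[OF _ l]) (auto intro!: always_eventually continuous_intros)
  moreover have "l y = qprod y q" if "y \<in> cball 0 r" for y
    using tendsto_uniform_limitI[OF l that] qprod_LIMSEQ[OF assms] by (rule LIMSEQ_unique)
  ultimately show ?thesis by (metis (no_types, lifting) continuous_on_cong)
qed

section \<open>Gauss's finite form of the triple product\<close>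

definition qfact :: "complex \<Rightarrow> nat \<Rightarrow> complex" where
  "qfact q n = (\<Prod>k<n. 1 - q ^ Suc k)"

definition inv_qfact :: "complex \<Rightarrow> int \<Rightarrow> complex" where
  "inv_qfact q m = (if m < 0 then 0 else 1 / qfact q (nat m))"

lemma qfact_nonzero: "norm q < 1 \<Longrightarrow> qfact q n \<noteq> 0"
  unfolding qfact_def using power_neq_1[of q] by (auto simp del: power_Suc)

text \<open>No sign condition on \<open>m\<close> is imposed: at \<open>m = 0\<close>, where
  \<open>inv_qfact\<close> jumps to 0, the factor \<open>1 - q powi m\<close> vanishes as
  well.\<close>

lemma inv_qfact_minus_1:
  assumes "norm q < 1" "m' = m - 1"
  shows "inv_qfact q m' = (1 - q powi m) * inv_qfact q m"
proof (cases "m > 0")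
  case True
  then obtain k where k: "m = int (Suc k)"
    by (metis Suc_pred zero_less_imp_eq_int of_nat_0_less_iff)
  have "qfact q (Suc k) = qfact q k * (1 - q ^ Suc k)" by (simp add: qfact_def)
  moreover have "nat m' = k" "nat m = Suc k" "\<not> m' < 0" "\<not> m < 0" "q powi m = q ^ Suc k"
    using k assms(2) by (auto simp: power_int_of_nat simp del: of_nat_Suc power_Suc)
  ultimately show ?thesis
    using qfact_nonzero[OF assms(1), of k] power_neq_1[OF assms(1), of k]
    by (simp add: inv_qfact_def del: power_Suc)
next
  case False
  then show ?thesis using assms(2) by (cases "m = 0") (auto simp: inv_qfact_def)
qed

text \<open>
  The \<open>q\<close>-binomial coefficient of \<open>2 n\<close> over \<open>n + j\<close>. As \<open>inv_qfact\<close> vanishes at negative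
  arguments, its recursion holds for all integers \<open>j\<close>, without boundary cases.
\<close>
definition gauss_coeff :: "complex \<Rightarrow> nat \<Rightarrow> int \<Rightarrow> complex" where
  "gauss_coeff q n j = qfact q (2 * n) * inv_qfact q (int n - j) * inv_qfact q (int n + j)"

lemma gauss_coeff_0: "gauss_coeff q 0 j = of_bool (j = 0)"
  by (auto simp: gauss_coeff_def inv_qfact_def qfact_def)

text \<open>Two q-Pascal steps at once, from 2 n to 2 n + 2. In terms of \<open>a\<close>,
  \<open>b\<close> with \<open>a * b = q ^ (2 * n + 2)\<close>, every summand is a multiple of
  \<open>A * B\<close>, and the claim becomes (1 - a b / q) (1 - a b) = (1 + a b / q) (1 - a) (1 -
  b) + a (1 - b / q) (1 - b) + b (1 - a / q) (1 - a).\<close>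

lemma gauss_coeff_Suc:
  assumes "norm q < 1" "q \<noteq> 0"
  shows "gauss_coeff q (Suc n) j = (1 + q ^ (2 * n + 1)) * gauss_coeff q n j
    + q ^ (n + 1) * q powi (-j) * gauss_coeff q n (j - 1) + q ^ n * q powi (j + 1) * gauss_coeff q n (j + 1)"
proof -
  define a b where "a = q powi (int n + 1 - j)" and "b = q powi (int n + 1 + j)"
  define A B where "A = inv_qfact q (int n + 1 - j)" and "B = inv_qfact q (int n + 1 + j)"
  have a': "a = q ^ (n + 1) * q powi (-j)"
  proof -
    have "a = q powi (int (n + 1) + - j)" by (simp add: a_def algebra_simps)
    also have "\<dots> = q powi int (n + 1) * q powi (-j)" using assms by (intro power_int_add) simp
    finally show ?thesis by (simp only: power_int_of_nat)
  qed
  have b': "b = q ^ n * q powi (j + 1)"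
  proof -
    have "b = q powi (int n + (j + 1))" by (simp add: b_def algebra_simps)
    also have "\<dots> = q powi int n * q powi (j + 1)" using assms by (intro power_int_add) simp
    finally show ?thesis by (simp only: power_int_of_nat)
  qed
  have aq: "q powi (int n - j) = a / q"
    unfolding a_def using assms power_int_diff[of q "int n + 1 - j" 1] by simp
  have bq: "q powi (int n + j) = b / q"
    unfolding b_def using assms power_int_diff[of q "int n + 1 + j" 1] by simp
  have ab: "q ^ (2 * n + 2) = a * b"
  proof -
    have "a * b = q powi ((int n + 1 - j) + (int n + 1 + j))"
      unfolding a_def b_def using assms by (intro power_int_add[symmetric]) simp
    also have "(int n + 1 - j) + (int n + 1 + j) = int (2 * n + 2)" by simp
    finally show ?thesis by (simp only: power_int_of_nat)
  qed
  have ab1: "q ^ (2 * n + 1) = a * b / q" using ab assms by (simp add: field_simps)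
  have A1: "inv_qfact q (int n - j) = (1 - a) * A" and A2: "inv_qfact q (int n - (j + 1)) = (1 - a / q) * ((1 - a) * A)"
    using inv_qfact_minus_1[OF assms(1), of "int n - j" "int n + 1 - j"]
      inv_qfact_minus_1[OF assms(1), of "int n - (j + 1)" "int n - j"] by (simp_all add: a_def A_def aq[unfolded a_def])
  have B1: "inv_qfact q (int n + j) = (1 - b) * B" and B2: "inv_qfact q (int n + (j - 1)) = (1 - b / q) * ((1 - b) * B)"
    using inv_qfact_minus_1[OF assms(1), of "int n + j" "int n + 1 + j"]
      inv_qfact_minus_1[OF assms(1), of "int n + (j - 1)" "int n + j"] by (simp_all add: b_def B_def bq[unfolded b_def])
  have "qfact q (2 * Suc n) = qfact q (2 * n) * (1 - q ^ (2 * n + 1)) * (1 - q ^ (2 * n + 2))"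
    by (simp add: qfact_def)
  then have "gauss_coeff q (Suc n) j = qfact q (2 * n) * (1 - a * b / q) * (1 - a * b) * A * B"
    by (simp only: gauss_coeff_def ab ab1) (simp add: A_def B_def algebra_simps)
  also have "\<dots> = (1 + a * b / q) * (qfact q (2 * n) * ((1 - a) * A) * ((1 - b) * B))
      + a * (qfact q (2 * n) * A * ((1 - b / q) * ((1 - b) * B)))
      + b * (qfact q (2 * n) * ((1 - a / q) * ((1 - a) * A)) * B)"
    using assms by (simp add: field_simps)
  also have "\<dots> = (1 + q ^ (2 * n + 1)) * gauss_coeff q n j
    + q ^ (n + 1) * q powi (-j) * gauss_coeff q n (j - 1) + q ^ n * q powi (j + 1) * gauss_coeff q n (j + 1)"
  proof -
    have "inv_qfact q (int n - (j - 1)) = A" "inv_qfact q (int n + (j + 1)) = B"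
      by (simp_all add: A_def B_def algebra_simps)
    then show ?thesis unfolding ab1 a'[symmetric] b'[symmetric] gauss_coeff_def A1 A2 B1 B2 by simp
  qed
  finally show ?thesis .
qed

text \<open>The new factor is (1 - x q^(n+1)) (1 - q^n / x) = (1 + q^(2n+1)) - x q^(n+1) - q^n / x,
  whose three parts match the three summands of \<open>gauss_coeff_Suc\<close> after shifts of the
  index. Keeping \<open>a\<close> abstract, given by its recursion alone, lets it be the terms of
  theta themselves, without fractional powers of \<open>q\<close>.\<close>

lemma gauss_finite_product:
  fixes a :: "int \<Rightarrow> complex"
  assumes q: "norm q < 1" "q \<noteq> 0" and x: "x \<noteq> 0"
    and a: "\<And>j. a (j + 1) = - x * q powi (j + 1) * a j"
  shows "((\<lambda>j. gauss_coeff q n j * a j) has_sum (a 0 * (\<Prod>k<n. (1 - x * q ^ Suc k) * (1 - q ^ k / x)))) UNIV"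
proof (induction n)
  case 0
  show ?case
    by (rule has_sum_finite_neutralI[of "{0}"]) (auto simp: gauss_coeff_0)
next
  case (Suc n)
  define P where "P = a 0 * (\<Prod>k<n. (1 - x * q ^ Suc k) * (1 - q ^ k / x))"
  have IH: "((\<lambda>j. gauss_coeff q n j * a j) has_sum P) UNIV" using Suc.IH by (simp add: P_def)
  have up: "((\<lambda>j. gauss_coeff q n (j + 1) * a (j + 1)) has_sum P) UNIV"
    by (subst has_sum_reindex_bij_witness[where T = UNIV and j = "\<lambda>n. n + 1" and i = "\<lambda>n. n - 1"
         and h = "\<lambda>j. gauss_coeff q n j * a j"]) (use IH in auto)
  have down: "((\<lambda>j. gauss_coeff q n (j - 1) * a (j - 1)) has_sum P) UNIV"
    by (subst has_sum_reindex_bij_witness[where T = UNIV and i = "\<lambda>n. n + 1" and j = "\<lambda>n. n - 1"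
         and h = "\<lambda>j. gauss_coeff q n j * a j"]) (use IH in auto)
  have *: "gauss_coeff q (Suc n) j * a j = (1 + q ^ (2 * n + 1)) * (gauss_coeff q n j * a j)
     + (- x * q ^ (n + 1)) * (gauss_coeff q n (j - 1) * a (j - 1))
     + (- (q ^ n / x)) * (gauss_coeff q n (j + 1) * a (j + 1))" for j
  proof -
    have a1: "q powi (- j) * a j = - x * a (j - 1)"
      using a[of "j - 1"] q by (simp add: power_int_minus)
    have a2: "q powi (j + 1) * a j = - a (j + 1) / x"
      using a[of j] x by (simp add: field_simps)
    show ?thesis
      unfolding gauss_coeff_Suc[OF q] 
      using arg_cong[OF a1, of "\<lambda>t. q ^ (n + 1) * gauss_coeff q n (j - 1) * t"] 
        arg_cong[OF a2, of "\<lambda>t. q ^ n * gauss_coeff q n (j + 1) * t"]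
      by (simp add: algebra_simps)
  qed
  have "((\<lambda>j. gauss_coeff q (Suc n) j * a j) has_sum
      ((1 + q ^ (2 * n + 1)) * P + (- x * q ^ (n + 1)) * P + (- (q ^ n / x)) * P)) UNIV"
    unfolding * by (intro has_sum_add has_sum_cmult_right IH up down)
  also have "(1 + q ^ (2 * n + 1)) * P + (- x * q ^ (n + 1)) * P + (- (q ^ n / x)) * P
     = P * ((1 - x * q ^ Suc n) * (1 - q ^ n / x))"
    using x by (simp add: field_simps mult_2_right power_add)
  also have "\<dots> = a 0 * (\<Prod>k<Suc n. (1 - x * q ^ Suc k) * (1 - q ^ k / x))"
    by (simp add: P_def)
  finally show ?case .
qed

lemma qfact_LIMSEQ: "norm q < 1 \<Longrightarrow> qfact q \<longlonglongrightarrow> qprod 1 q"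
  using qprod_LIMSEQ[of q 1] by (simp add: qfact_def[abs_def])

lemma inv_qfact_LIMSEQ:
  assumes "norm q < 1" "filterlim f at_top sequentially"
  shows "(\<lambda>n. inv_qfact q (f n)) \<longlonglongrightarrow> 1 / qprod 1 q"
proof -
  have "filterlim (\<lambda>n. nat (f n)) sequentially sequentially"
    using filterlim_compose[OF filterlim_nat_sequentially assms(2)] .
  then have "(\<lambda>n. 1 / qfact q (nat (f n))) \<longlonglongrightarrow> 1 / qprod 1 q"
    by (intro tendsto_divide tendsto_const filterlim_compose[OF qfact_LIMSEQ] assms qprod_1_nonzero)
  moreover have "\<forall>\<^sub>F n in sequentially. 0 \<le> f n"
    using assms(2) by (simp add: filterlim_at_top)
  then have "\<forall>\<^sub>F n in sequentially. 1 / qfact q (nat (f n)) = inv_qfact q (f n)"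
    by eventually_elim (simp add: inv_qfact_def)
  ultimately show ?thesis by (rule Lim_transform_eventually)
qed

lemma gauss_coeff_LIMSEQ:
  assumes "norm q < 1"
  shows "(\<lambda>n. gauss_coeff q n j) \<longlonglongrightarrow> 1 / qprod 1 q"
proof -
  have l: "filterlim (\<lambda>n. int n + c) at_top sequentially" for c
  proof (unfold filterlim_at_top eventually_sequentially, intro allI)
    fix Z show "\<exists>N. \<forall>n\<ge>N. Z \<le> int n + c" by (rule exI[of _ "nat (Z - c)"]) auto
  qed
  have "filterlim (\<lambda>n::nat. 2 * n) sequentially sequentially"
    by (rule filterlim_subseq) (auto simp: strict_mono_def)
  then have "(\<lambda>n. qfact q (2 * n)) \<longlonglongrightarrow> qprod 1 q"
    by (rule filterlim_compose[OF qfact_LIMSEQ[OF assms]])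
  then have "(\<lambda>n. gauss_coeff q n j) \<longlonglongrightarrow> qprod 1 q * (1 / qprod 1 q) * (1 / qprod 1 q)"
    unfolding gauss_coeff_def using l[of j] l[of "-j"]
    by (intro tendsto_mult inv_qfact_LIMSEQ assms) auto
  then show ?thesis using qprod_1_nonzero[OF assms] by simp
qed

text \<open>Provides the majorant for the passage to the limit: convergent sequences are bounded,
  both for the q-factorials and for their reciprocals.\<close>

lemma gauss_coeff_bounded:
  assumes "norm q < 1"
  shows "\<exists>M. \<forall>n j. norm (gauss_coeff q n j) \<le> M"
proof -
  have "Bseq (qfact q)" by (rule convergent_imp_Bseq) (use qfact_LIMSEQ[OF assms] in \<open>auto simp: convergent_def\<close>)
  then obtain K where K: "K > 0" "\<And>n. norm (qfact q n) \<le> K" by (auto simp: Bseq_def)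
  have "(\<lambda>n. 1 / qfact q n) \<longlonglongrightarrow> 1 / qprod 1 q"
    by (intro tendsto_divide tendsto_const qfact_LIMSEQ assms qprod_1_nonzero)
  then have "Bseq (\<lambda>n. 1 / qfact q n)" by (intro convergent_imp_Bseq) (auto simp: convergent_def)
  then obtain L where L: "L > 0" "\<And>n. norm (1 / qfact q n) \<le> L" by (auto simp: Bseq_def)
  have L': "norm (inv_qfact q m) \<le> L" for m
    using L(2)[of "nat m"] L(1) by (simp add: inv_qfact_def)
  have "norm (gauss_coeff q n j) \<le> K * L * L" for n j
    unfolding gauss_coeff_def norm_mult by (intro mult_mono K L') (use K L in auto)
  then show ?thesis by blast
qed

section \<open>The limit of the finite form\<close>

definition nome :: "complex \<Rightarrow> complex" where
  "nome \<tau> = exp (2 * of_real pi * \<i> * \<tau>)"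

lemma nome_nonzero [simp]: "nome \<tau> \<noteq> 0"
  by (simp add: nome_def)

lemma norm_nome: "Im \<tau> > 0 \<Longrightarrow> norm (nome \<tau>) < 1"
  by (simp add: nome_def)

lemma nome_add: "nome (a + b) = nome a * nome b"
  by (simp add: nome_def exp_add algebra_simps)

lemma nome_minus: "nome (- a) = 1 / nome a"
  by (simp add: nome_def exp_minus field_simps)

lemma nome_of_nat_mult: "nome (of_nat n * a) = nome a ^ n"
  by (simp add: nome_def mult_ac flip: exp_of_nat_mult)

lemma nome_of_int_mult: "nome (of_int n * a) = nome a powi n"
  unfolding nome_def exp_power_int by (simp add: mult_ac)

lemma theta_term_0_Suc:
  "theta_term 0 z \<tau> (j + 1) = - nome z * nome \<tau> powi (j + 1) * theta_term 0 z \<tau> j"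
proof -
  have "of_real pi * \<i> * \<tau> * shift_half (j + 1) ^ 2 + 2 * of_real pi * \<i> * shift_half (j + 1) * (z + 1/2)
     = 2 * of_real pi * \<i> * z + 2 * of_real pi * \<i> * (of_int (j + 1) * \<tau>) + of_real pi * \<i>
      + (of_real pi * \<i> * \<tau> * shift_half j ^ 2 + 2 * of_real pi * \<i> * shift_half j * (z + 1/2))"
    by (simp add: shift_half_def power2_eq_square algebra_simps)
  then show ?thesis
    unfolding theta_term_def nome_of_int_mult[symmetric] unfolding nome_def
    by (simp only: exp_add exp_pi_i power_0 mult_1) simp
qed

theorem jacobi_triple_product:
  assumes "Im \<tau> > 0"
  shows "theta 0 z \<tau> = theta_term 0 z \<tau> 0 * (1 - nome (- z)) *
    (qprod 1 (nome \<tau>) * qprod (nome z) (nome \<tau>) * qprod (nome (- z)) (nome \<tau>))"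
proof -
  define q x where "q = nome \<tau>" and "x = nome z"
  define a where "a = theta_term 0 z \<tau>"
  have q: "norm q < 1" "q \<noteq> 0" and x: "x \<noteq> 0" using assms by (auto simp: q_def x_def norm_nome)
  have "((\<lambda>j. gauss_coeff q n j * a j) has_sum (a 0 * (\<Prod>k<n. (1 - x * q ^ Suc k) * (1 - q ^ k / x)))) UNIV" for n
    by (rule gauss_finite_product[OF q x]) (simp add: a_def theta_term_0_Suc q_def x_def)
  moreover obtain M where M: "\<And>n j. norm (gauss_coeff q n j) \<le> M" using gauss_coeff_bounded[OF q(1)] by blast
  have "norm (gauss_coeff q n j * a j) \<le> M * norm (a j)" for n j
    unfolding norm_mult by (intro mult_right_mono M) auto
  moreover have "(\<lambda>j. M * norm (a j)) summable_on UNIV"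
    unfolding a_def by (intro summable_on_cmult_right abs_summable_theta_term assms)
  moreover have "(\<lambda>n. gauss_coeff q n j * a j) \<longlonglongrightarrow> 1 / qprod 1 q * a j" for j
    by (intro tendsto_mult tendsto_const gauss_coeff_LIMSEQ q)
  moreover have "((\<lambda>j. 1 / qprod 1 q * a j) has_sum (1 / qprod 1 q * theta 0 z \<tau>)) UNIV"
    unfolding a_def by (intro has_sum_cmult_right has_sum_theta assms)
  ultimately have lim1: "(\<lambda>n. a 0 * (\<Prod>k<n. (1 - x * q ^ Suc k) * (1 - q ^ k / x))) \<longlonglongrightarrow> 1 / qprod 1 q * theta 0 z \<tau>"
    by (rule tendsto_has_sum_dominated)
  \<comment> \<open>The factors \<open>1 - q ^ k / x\<close> start at exponent 0 but
    \<open>qprod\<close> starts at exponent 1. Taking \<open>Suc n\<close> factors splits off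
    \<open>1 - 1 / x\<close>, the factor responsible for the zero at z = 0.\<close>
  have "(\<lambda>n. a 0 * ((\<Prod>k<Suc n. 1 - x * q ^ Suc k) * ((1 - 1 / x) * (\<Prod>k<n. 1 - (1 / x) * q ^ Suc k))))
      \<longlonglongrightarrow> a 0 * (qprod x q * ((1 - 1 / x) * qprod (1 / x) q))"
    by (intro tendsto_mult tendsto_const LIMSEQ_Suc qprod_LIMSEQ q)
  also have "(\<lambda>n. a 0 * ((\<Prod>k<Suc n. 1 - x * q ^ Suc k) * ((1 - 1 / x) * (\<Prod>k<n. 1 - (1 / x) * q ^ Suc k))))
      = (\<lambda>n. a 0 * (\<Prod>k<Suc n. (1 - x * q ^ Suc k) * (1 - q ^ k / x)))"
  proof -
    have "(\<Prod>k<Suc n. 1 - q ^ k / x) = (1 - 1 / x) * (\<Prod>k<n. 1 - (1 / x) * q ^ Suc k)" for n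
      by (subst prod.lessThan_Suc_shift) simp
    then show ?thesis by (simp only: prod.distrib)
  qed
  finally have "(\<lambda>n. a 0 * (\<Prod>k<n. (1 - x * q ^ Suc k) * (1 - q ^ k / x)))
      \<longlonglongrightarrow> a 0 * (qprod x q * ((1 - 1 / x) * qprod (1 / x) q))"
    by (rule LIMSEQ_imp_Suc)
  with lim1 have "1 / qprod 1 q * theta 0 z \<tau> = a 0 * (qprod x q * ((1 - 1 / x) * qprod (1 / x) q))"
    by (rule LIMSEQ_unique)
  then show ?thesis
    using qprod_1_nonzero[OF q(1)] unfolding a_def[symmetric] nome_minus q_def[symmetric] x_def[symmetric]
    by (simp add: field_simps)
qed

section \<open>Special values of theta\<close>

lemma nome_eq_1_iff: "nome w = 1 \<longleftrightarrow> (\<exists>m::int. w = of_int m)"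
proof -
  have "nome w = 1 \<longleftrightarrow> exp (2 * of_real pi * \<i> * w) = exp 0" by (simp add: nome_def)
  also have "\<dots> \<longleftrightarrow> (\<exists>m::int. 2 * of_real pi * \<i> * w = 0 + of_int (2 * m) * of_real pi * \<i>)" 
    unfolding exp_eq by (simp add: mult_ac)
  also have "\<dots> \<longleftrightarrow> (\<exists>m::int. w = of_int m)" by (intro arg_cong[where f = Ex] ext) auto
  finally show ?thesis .
qed

definition period_lattice :: "complex \<Rightarrow> complex set" where
  "period_lattice \<tau> = {of_int m + of_int n * \<tau> | m n. True}"

text \<open>A convergent product vanishes only if one of its factors does, and a vanishing factor
  means that \<open>z\<close> plus a multiple of \<open>\<tau>\<close> is an integer.\<close>

lemma theta_nonzero:
  assumes "Im \<tau> > 0" "z \<notin> period_lattice \<tau>"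
  shows "theta 0 z \<tau> \<noteq> 0"
proof -
  have *: "nome (z + of_int n * \<tau>) \<noteq> 1" for n
  proof
    assume "nome (z + of_int n * \<tau>) = 1"
    then obtain m :: int where "z + of_int n * \<tau> = of_int m" unfolding nome_eq_1_iff by blast
    then have "z = of_int m + of_int (- n) * \<tau>" by (simp add: algebra_simps)
    with assms(2) show False unfolding period_lattice_def by blast
  qed
  have "nome (- z) \<noteq> 1" using *[of 0] by (simp add: nome_minus)
  moreover have "qprod (nome z) (nome \<tau>) \<noteq> 0"
  proof (rule qprod_nonzero)
    show "nome z * nome \<tau> ^ Suc n \<noteq> 1" for n
      using *[of "int (Suc n)"] by (simp add: nome_add nome_of_nat_mult del: of_nat_Suc power_Suc)
  qed (simp add: norm_nome assms)
  moreover have "qprod (nome (- z)) (nome \<tau>) \<noteq> 0"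
  proof (rule qprod_nonzero)
    show "nome (- z) * nome \<tau> ^ Suc n \<noteq> 1" for n
    proof
      assume "nome (- z) * nome \<tau> ^ Suc n = 1"
      moreover have "- (z + of_int (- int (Suc n)) * \<tau>) = - z + of_nat (Suc n) * \<tau>" by (simp add: algebra_simps)
      ultimately have "nome (- (z + of_int (- int (Suc n)) * \<tau>)) = 1"
        by (simp only: nome_add nome_of_nat_mult)
      then show False using *[of "- int (Suc n)"] by (simp only: nome_minus) (simp add: field_simps)
    qed
  qed (simp add: norm_nome assms)
  ultimately show ?thesis
    unfolding jacobi_triple_product[OF assms(1)] using qprod_1_nonzero[OF norm_nome[OF assms(1)]]
    by (simp add: theta_term_def)
qed

lemma theta_eta_prefactor:
  "theta_term 0 z \<tau> 0 * (1 - nome (- z)) = \<i> * nome (\<tau> / 8) * (nome (z / 2) - nome (- z / 2))"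
proof -
  have "theta_term 0 z \<tau> 0 = exp (2 * of_real pi * \<i> * (\<tau> / 8) + (2 * of_real pi * \<i> * (z / 2) + of_real pi / 2 * \<i>))"
    by (simp add: theta_term_def shift_half_def power2_eq_square algebra_simps)
  also have "\<dots> = nome (\<tau> / 8) * (nome (z / 2) * exp (of_real pi / 2 * \<i>))"
    by (simp only: nome_def exp_add)
  also have "exp (of_real pi / 2 * \<i>) = \<i>"
    using cis_pi_half by (simp add: cis_conv_exp mult_ac)
  finally have "theta_term 0 z \<tau> 0 * (1 - nome (- z)) = \<i> * nome (\<tau> / 8) * (nome (z / 2) - nome (z / 2) * nome (- z))"
    by (simp add: algebra_simps)
  also have "nome (z / 2) * nome (- z) = nome (- z / 2)" by (simp flip: nome_add)
  finally show ?thesis .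
qed

section \<open>The eta function and Jacobi's derivative formula\<close>

lemma dedekind_eta_eq: "dedekind_eta \<tau> = nome (\<tau> / 24) * qprod 1 (nome \<tau>)"
proof -
  have "exp (2 * of_real pi * \<i> * of_nat (Suc n) * \<tau>) = nome \<tau> ^ Suc n" for n
    by (simp only: nome_of_nat_mult[symmetric]) (simp only: nome_def mult.assoc)
  then show ?thesis by (simp add: dedekind_eta_def qprod_def nome_def del: power_Suc of_nat_Suc)
qed

lemma dedekind_eta_nonzero: "Im \<tau> > 0 \<Longrightarrow> dedekind_eta \<tau> \<noteq> 0"
  by (simp add: dedekind_eta_eq qprod_1_nonzero norm_nome)

lemma theta_0_0: "Im \<tau> > 0 \<Longrightarrow> theta 0 0 \<tau> = 0"
  using theta_minus[of \<tau> 0 0] by simp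

text \<open>At a zero of \<open>u\<close> the product rule asks only for continuity of
  \<open>H\<close>; thus the infinite products need not be differentiated.\<close>

lemma DERIV_mult_continuous:
  fixes u H :: "complex \<Rightarrow> complex"
  assumes "(u has_field_derivative D) (at z)" "u z = 0" "isCont H z"
  shows "((\<lambda>w. u w * H w) has_field_derivative D * H z) (at z)"
proof -
  have "(\<lambda>w. (u w - u z) / (w - z)) \<midarrow>z\<rightarrow> D" using assms(1) by (simp add: has_field_derivative_iff)
  then have "(\<lambda>w. (u w - u z) / (w - z) * H w) \<midarrow>z\<rightarrow> D * H z"
    using assms(3) by (intro tendsto_mult) (simp_all add: isCont_def)
  then show ?thesis using assms(2) by (simp add: has_field_derivative_iff)
qed

text \<open>Once the simple zero at z = 0 is split off, all three infinite products become Euler's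
  product, and \<open>nome (\<tau> / 8)\<close> is the cube of
  \<open>nome (\<tau> / 24)\<close>.\<close>

lemma theta_1_0:
  assumes "Im \<tau> > 0"
  shows "theta 1 0 \<tau> = \<i> * dedekind_eta \<tau> ^ 3"
proof -
  define q where "q = nome \<tau>"
  define H where "H = (\<lambda>z. \<i> * nome (\<tau> / 8) * (qprod 1 q * qprod (nome z) q * qprod (nome (- z)) q))"
  have q: "norm q < 1" by (simp add: q_def norm_nome assms)
  have cont: "isCont (\<lambda>y. qprod y q) 1"
    using continuous_on_qprod[OF q, of 2] by (rule continuous_on_interior) (simp add: interior_cball)
  have nome_cont: "isCont nome 0" "isCont (\<lambda>z. nome (- z)) 0"
    unfolding nome_def by (intro continuous_intros)+
  have "isCont (\<lambda>z. qprod (nome z) q) 0"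
    by (rule isCont_o2[OF nome_cont(1), of "\<lambda>y. qprod y q"]) (simp add: nome_def cont)
  moreover have "isCont (\<lambda>z. qprod (nome (- z)) q) 0"
    by (rule isCont_o2[OF nome_cont(2), of "\<lambda>y. qprod y q"]) (simp add: nome_def cont)
  ultimately have "isCont H 0"
    unfolding H_def by (intro continuous_mult continuous_const)
  moreover have "((\<lambda>z. nome (z / 2) - nome (- z / 2)) has_field_derivative 2 * of_real pi * \<i>) (at 0)"
  proof -
    have "((\<lambda>z. exp (of_real pi * \<i> * z) - exp (- of_real pi * \<i> * z)) has_field_derivative 2 * of_real pi * \<i>) (at 0)"
      by (auto intro!: derivative_eq_intros)
    then show ?thesis by (simp add: nome_def mult.assoc)
  qed
  ultimately have "((\<lambda>z. (nome (z / 2) - nome (- z / 2)) * H z) has_field_derivative 2 * of_real pi * \<i> * H 0) (at 0)"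
    by (intro DERIV_mult_continuous) simp_all
  also have "(\<lambda>z. (nome (z / 2) - nome (- z / 2)) * H z) = (\<lambda>z. theta 0 z \<tau>)"
    unfolding jacobi_triple_product[OF assms] theta_eta_prefactor H_def q_def by (simp only: mult_ac)
  finally have "2 * of_real pi * \<i> * H 0 = 2 * of_real pi * \<i> * theta 1 0 \<tau>"
    using DERIV_theta_z[OF assms, of 0 0] DERIV_unique by fastforce
  then have "theta 1 0 \<tau> = H 0" by simp
  also have "H 0 = \<i> * dedekind_eta \<tau> ^ 3"
  proof -
    have "nome (\<tau> / 8) = nome (of_nat 3 * (\<tau> / 24))" by simp
    also have "\<dots> = nome (\<tau> / 24) ^ 3" by (rule nome_of_nat_mult)
    finally show ?thesis
      by (simp add: H_def q_def dedekind_eta_eq power3_eq_cube nome_def[of 0] mult_ac)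
  qed
  finally show ?thesis .
qed

section \<open>Values at the points of order 3 and 6\<close>

lemma nome_of_real: "nome (of_real r) = cis (2 * pi * r)"
  by (simp add: nome_def cis_conv_exp mult_ac)

lemma theta_of_real:
  assumes "Im \<tau> > 0"
  shows "theta 0 (of_real r) \<tau> = - 2 * of_real (sin (pi * r)) * nome (\<tau> / 8) *
    (qprod 1 (nome \<tau>) * qprod (cis (2 * pi * r)) (nome \<tau>) * qprod (cis (- (2 * pi * r))) (nome \<tau>))"
proof -
  have "nome (of_real r / 2) = cis (pi * r)" "nome (- of_real r / 2) = cis (- (pi * r))"
    "nome (- of_real r) = cis (- (2 * pi * r))"
    using nome_of_real[of "r / 2"] nome_of_real[of "- r / 2"] nome_of_real[of "- r"] by simp_all
  moreover have "\<i> * (cis (pi * r) - cis (- (pi * r))) = - 2 * of_real (sin (pi * r))"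
    by (intro complex_eqI) auto
  moreover have "\<i> * N * (A - B) * Q = (\<i> * (A - B)) * N * Q" for N A B Q by (simp only: mult_ac)
  ultimately show ?thesis
    unfolding jacobi_triple_product[OF assms] theta_eta_prefactor nome_of_real by (simp only:)
qed

lemma qprod_cube_roots:
  assumes "norm q < 1"
  shows "qprod 1 q * qprod (cis (2 * pi / 3)) q * qprod (cis (- (2 * pi / 3))) q = qprod 1 (q ^ 3)"
proof -
  define w w' where "w = cis (2 * pi / 3)" and "w' = cis (- (2 * pi / 3))"
  have w: "w + w' = -1" "w * w' = 1"
    by (simp_all add: w_def w'_def complex_eq_iff cos_120 cis_mult)
  have *: "(1 - 1 * t) * (1 - w * t) * (1 - w' * t) = 1 - t ^ 3" for t :: complex
    using w by algebra
  note conv = convergent_prod_qprod[OF assms]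
  have "qprod 1 q * qprod w q * qprod w' q = (\<Prod>n. (1 - 1 * q ^ Suc n) * (1 - w * q ^ Suc n) * (1 - w' * q ^ Suc n))"
    unfolding qprod_def by (simp only: prodinf_mult convergent_prod_mult conv)
  also have "\<dots> = qprod 1 (q ^ 3)"
    unfolding * qprod_def by (simp only: power_mult[symmetric] mult.commute[of 3] mult_1)
  finally show ?thesis by (simp add: w_def w'_def)
qed

text \<open>Factor by factor this is the sixth cyclotomic polynomial, 1 - t + t^2 = (1 - t) (1 -
  t^6) / ((1 - t^2) (1 - t^3)), with the denominators cleared.\<close>

lemma qprod_sixth_roots:
  assumes "norm q < 1"
  shows "qprod (cis (pi / 3)) q * qprod (cis (- (pi / 3))) q * qprod 1 (q\<^sup>2) * qprod 1 (q ^ 3)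
    = qprod 1 q * qprod 1 (q ^ 6)"
proof -
  define w w' where "w = cis (pi / 3)" and "w' = cis (- (pi / 3))"
  have w: "w + w' = 1" "w * w' = 1"
    by (simp_all add: w_def w'_def complex_eq_iff cos_60 cis_mult)
  have *: "(1 - w * t) * (1 - w' * t) * (1 - 1 * t ^ 2) * (1 - 1 * t ^ 3) = (1 - 1 * t) * (1 - 1 * t ^ 6)" for t :: complex
  proof -
    have "(1 - w * t) * (1 - w' * t) = 1 - t + t ^ 2" using w by algebra
    then show ?thesis by algebra
  qed
  note conv = convergent_prod_qprod[OF assms] 
  have convk: "convergent_prod (\<lambda>n. 1 - 1 * (q ^ Suc n) ^ k)" if "k > 0" for k
  proof -
    have "norm (q ^ k) < 1" using assms that by (simp add: norm_power power_less_one_iff)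
    from convergent_prod_qprod[OF this, of 1] show ?thesis
      by (simp only: power_mult[symmetric] mult.commute[of k])
  qed
  have q: "qprod 1 (q ^ k) = (\<Prod>n. 1 - 1 * (q ^ Suc n) ^ k)" for k
    unfolding qprod_def by (simp only: power_mult[symmetric] mult.commute[of k])
  have "qprod w q * qprod w' q * qprod 1 (q\<^sup>2) * qprod 1 (q ^ 3) = 
     (\<Prod>n. (1 - w * q ^ Suc n) * (1 - w' * q ^ Suc n) * (1 - 1 * (q ^ Suc n) ^ 2) * (1 - 1 * (q ^ Suc n) ^ 3))"
    unfolding q qprod_def[of w] qprod_def[of w'] by (simp only: prodinf_mult convergent_prod_mult conv convk zero_less_numeral)
  also have "\<dots> = (\<Prod>n. (1 - 1 * q ^ Suc n) * (1 - 1 * (q ^ Suc n) ^ 6))" unfolding * ..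
  also have "\<dots> = qprod 1 q * qprod 1 (q ^ 6)"
    unfolding q qprod_def[of _ q] by (simp only: prodinf_mult convergent_prod_mult conv convk zero_less_numeral)
  finally show ?thesis by (simp add: w_def w'_def)
qed

lemma nome_numeral_mult: "nome (numeral k * \<tau>) = nome \<tau> ^ numeral k"
  using nome_of_nat_mult[of "numeral k" \<tau>] by simp

lemma theta_third:
  assumes "Im \<tau> > 0"
  shows "theta 0 (1/3) \<tau> = - of_real (sqrt 3) * dedekind_eta (3 * \<tau>)"
proof -
  have "sin (pi * (1/3)) = sqrt 3 / 2" using sin_60 by simp
  from theta_of_real[OF assms, of "1/3", unfolded this] show ?thesis
    using qprod_cube_roots[OF norm_nome[OF assms]]
    by (simp add: dedekind_eta_eq nome_numeral_mult)
qed

lemma theta_sixth: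
  assumes "Im \<tau> > 0"
  shows "theta 0 (1/6) \<tau> * (dedekind_eta (2 * \<tau>) * dedekind_eta (3 * \<tau>)) = - (dedekind_eta \<tau> ^ 2 * dedekind_eta (6 * \<tau>))"
proof -
  define n where "n = nome (\<tau> / 24)"
  define q where "q = nome \<tau>"
  have n: "nome (\<tau> / 8) = n ^ 3" "nome (2 * \<tau> / 24) = n ^ 2" "nome (3 * \<tau> / 24) = n ^ 3" "nome (6 * \<tau> / 24) = n ^ 6"
    using nome_of_nat_mult[of 2 "\<tau> / 24"] nome_of_nat_mult[of 3 "\<tau> / 24"] nome_of_nat_mult[of 6 "\<tau> / 24"]
    by (simp_all add: n_def)
  have s: "sin (pi * (1/6)) = 1/2" using sin_30 by simp
  have "theta 0 (1/6) \<tau> = - (n ^ 3 * (qprod 1 q * (qprod (cis (pi/3)) q * qprod (cis (- (pi/3))) q)))"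
    using theta_of_real[OF assms, of "1/6", unfolded s] n by (simp add: q_def)
  then have "theta 0 (1/6) \<tau> * (dedekind_eta (2 * \<tau>) * dedekind_eta (3 * \<tau>)) = - (n ^ 8 * (qprod 1 q *
     (qprod (cis (pi / 3)) q * qprod (cis (- (pi / 3))) q * qprod 1 (q\<^sup>2) * qprod 1 (q ^ 3))))"
    unfolding dedekind_eta_eq n nome_numeral_mult q_def[symmetric] by algebra
  also have "\<dots> = - (n ^ 8 * (qprod 1 q * (qprod 1 q * qprod 1 (q ^ 6))))"
    unfolding q_def by (subst qprod_sixth_roots[OF norm_nome[OF assms]]) simp
  also have "\<dots> = - (dedekind_eta \<tau> ^ 2 * dedekind_eta (6 * \<tau>))"
    unfolding dedekind_eta_eq n nome_numeral_mult q_def[symmetric] n_def[symmetric] by algebra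
  finally show ?thesis .
qed

lemma eta_quotient_theta:
  assumes "Im \<tau> > 0"
  shows "theta 0 (1/3) \<tau> ^ 4 = 9 * eta_quotient \<tau> * theta 0 (1/6) \<tau> ^ 4"
proof -
  have nz: "dedekind_eta \<tau> \<noteq> 0" "dedekind_eta (2 * \<tau>) \<noteq> 0" "dedekind_eta (3 * \<tau>) \<noteq> 0" "dedekind_eta (6 * \<tau>) \<noteq> 0"
    using assms by (intro dedekind_eta_nonzero; simp)+
  have s: "(sqrt 3) ^ 4 = 9" by (simp add: power4_eq_xxxx)
  have t: "theta 0 (1/6) \<tau> = - (dedekind_eta \<tau> ^ 2 * dedekind_eta (6 * \<tau>)) / (dedekind_eta (2 * \<tau>) * dedekind_eta (3 * \<tau>))"
    using theta_sixth[OF assms] nz by (simp add: field_simps)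
  have "theta 0 (1/3) \<tau> ^ 4 = of_real ((sqrt 3) ^ 4) * dedekind_eta (3 * \<tau>) ^ 4"
    unfolding theta_third[OF assms] by (simp add: power_mult_distrib)
  also have "\<dots> = 9 * dedekind_eta (3 * \<tau>) ^ 4"
    unfolding s by simp
  also have "\<dots> = 9 * eta_quotient \<tau> * theta 0 (1/6) \<tau> ^ 4"
  proof -
    have "theta 0 (1/6) \<tau> ^ 4 = dedekind_eta \<tau> ^ 8 * dedekind_eta (6 * \<tau>) ^ 4 /
        (dedekind_eta (2 * \<tau>) ^ 4 * dedekind_eta (3 * \<tau>) ^ 4)"
      unfolding t by (simp add: power_divide power_mult_distrib flip: power_mult)
    then show ?thesis unfolding eta_quotient_def using nz by (simp add: eq_divide_eq) algebra
  qed
  finally show ?thesis .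
qed

section \<open>The cubic theta function\<close>

lemma has_sum_product:
  fixes f :: "'a \<Rightarrow> complex" and g :: "'b \<Rightarrow> complex"
  assumes f: "(\<lambda>x. norm (f x)) summable_on UNIV" and g: "(\<lambda>y. norm (g y)) summable_on UNIV"
    and a: "(f has_sum a) UNIV" and b: "(g has_sum b) UNIV"
  shows "(\<lambda>(x, y). norm (f x * g y)) summable_on UNIV"
    and "((\<lambda>(x, y). f x * g y) has_sum (a * b)) UNIV"
proof -
  have "(\<lambda>p. norm ((\<lambda>(x, y). f x * g y) p)) summable_on Sigma UNIV (\<lambda>_. UNIV)"
    unfolding Infinite_Sum.abs_summable_on_Sigma_iff
  proof (intro conjI ballI)
    show "(\<lambda>y. norm (case (x, y) of (x, y) \<Rightarrow> f x * g y)) summable_on UNIV" for x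
      using g by (simp add: norm_mult summable_on_cmult_right)
    have "(\<lambda>x. norm (f x) * (\<Sum>\<^sub>\<infinity>y. norm (g y))) summable_on UNIV"
      using f by (intro summable_on_cmult_left)
    then show "(\<lambda>x. norm (\<Sum>\<^sub>\<infinity>y. norm (case (x, y) of (x, y) \<Rightarrow> f x * g y))) summable_on UNIV"
      by (simp add: norm_mult infsum_cmult_right' abs_mult infsum_nonneg)
  qed
  then have s: "(\<lambda>p. norm ((\<lambda>(x, y). f x * g y) p)) summable_on UNIV \<times> UNIV" .
  then show "(\<lambda>(x, y). norm (f x * g y)) summable_on UNIV" by (simp add: case_prod_unfold)
  have "((\<lambda>(x, y). f x * g y) has_sum (a * b)) (UNIV \<times> UNIV)"
  proof (rule has_sum_SigmaI)
    show "((\<lambda>y. case (x, y) of (x, y) \<Rightarrow> f x * g y) has_sum f x * b) UNIV" for x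
      using has_sum_cmult_right[OF b, of "f x"] by simp
    show "((\<lambda>x. f x * b) has_sum a * b) UNIV" by (rule has_sum_cmult_left[OF a])
    show "(\<lambda>(x, y). f x * g y) summable_on UNIV \<times> UNIV"
      using s by (rule Infinite_Sum.abs_summable_summable)
  qed
  then show "((\<lambda>(x, y). f x * g y) has_sum (a * b)) UNIV" by simp
qed

text \<open>The zeros of theta(z, 3 \<open>\<tau>\<close>) translated by \<open>\<tau>\<close>, 0
  and - \<open>\<tau>\<close> fill the period lattice of \<open>\<tau>\<close>. The product of the
  three theta functions is therefore theta(z, \<open>\<tau>\<close>) times a factor depending on
  \<open>\<tau>\<close> alone, and this factor is the cubic series.\<close>

definition triple_term :: "complex \<Rightarrow> complex \<Rightarrow> int \<times> int \<times> int \<Rightarrow> complex" where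
  "triple_term z \<tau> = (\<lambda>(a, b, c). theta_term 0 (z - \<tau>) (3 * \<tau>) a *
     (theta_term 0 z (3 * \<tau>) b * theta_term 0 (z + \<tau>) (3 * \<tau>) c))"

lemma triple_term_shift:
  "triple_term z \<tau> (c + 1, a, b) = - nome z * nome (of_int (a + b + c + 2) * \<tau>) * triple_term z \<tau> (a, b, c)"
proof -
  let ?E = "\<lambda>w n. of_real pi * \<i> * (3 * \<tau>) * shift_half n ^ 2 + 2 * of_real pi * \<i> * shift_half n * (w + 1/2)"
  have "?E (z - \<tau>) (c + 1) + (?E z a + ?E (z + \<tau>) b) =
      of_real pi * \<i> + (2 * of_real pi * \<i> * z + (2 * of_real pi * \<i> * (of_int (a + b + c + 2) * \<tau>)
        + (?E (z - \<tau>) a + (?E z b + ?E (z + \<tau>) c))))"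
    by (simp add: shift_half_def power2_eq_square field_simps)
  then have "exp (?E (z - \<tau>) (c + 1)) * (exp (?E z a) * exp (?E (z + \<tau>) b)) =
      exp (of_real pi * \<i>) * (exp (2 * of_real pi * \<i> * z) * (exp (2 * of_real pi * \<i> * (of_int (a + b + c + 2) * \<tau>))
        * (exp (?E (z - \<tau>) a) * (exp (?E z b) * exp (?E (z + \<tau>) c)))))"
    by (simp only: exp_add[symmetric])
  then show ?thesis
    by (simp only: triple_term_def theta_term_def power_0 mult_1 nome_def exp_pi_i prod.case) simp
qed

lemma triple_term_sum_half:
  "triple_term z \<tau> (- 1 - b - c, b, c) =
     theta_term 0 z \<tau> 0 * nome (of_int (3 * (b\<^sup>2 + b * c + c\<^sup>2) + 4 * b + 5 * c + 2) * \<tau>)"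
proof -
  let ?E = "\<lambda>t w n. of_real pi * \<i> * t * shift_half n ^ 2 + 2 * of_real pi * \<i> * shift_half n * (w + 1/2)"
  have "?E (3 * \<tau>) (z - \<tau>) (- 1 - b - c) + (?E (3 * \<tau>) z b + ?E (3 * \<tau>) (z + \<tau>) c) =
      ?E \<tau> z 0 + 2 * of_real pi * \<i> * (of_int (3 * (b\<^sup>2 + b * c + c\<^sup>2) + 4 * b + 5 * c + 2) * \<tau>)"
    by (simp add: shift_half_def power2_eq_square field_simps)
  then show ?thesis
    by (simp only: triple_term_def theta_term_def power_0 mult_1 nome_def prod.case exp_add[symmetric])
qed

lemma abs_summable_triple_term:
  assumes "Im \<tau> > 0"
  shows "(\<lambda>p. norm (triple_term z \<tau> p)) summable_on UNIV"
    and "(triple_term z \<tau> has_sum (theta 0 (z - \<tau>) (3 * \<tau>) * (theta 0 z (3 * \<tau>) * theta 0 (z + \<tau>) (3 * \<tau>)))) UNIV"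
proof -
  have \<tau>: "Im (3 * \<tau>) > 0" using assms by simp
  note sums = abs_summable_theta_term[OF \<tau>] has_sum_theta[OF \<tau>]
  have *: "(\<lambda>p. norm ((\<lambda>(b, c). theta_term 0 z (3 * \<tau>) b * theta_term 0 (z + \<tau>) (3 * \<tau>) c) p)) summable_on UNIV"
    using has_sum_product(1)[OF sums(1,1,2,2), of 0 z 0 "z + \<tau>"] by (simp add: case_prod_unfold)
  note ** = has_sum_product[OF sums(1) * sums(2) has_sum_product(2)[OF sums(1,1,2,2)], of 0 "z - \<tau>"]
  show "(\<lambda>p. norm (triple_term z \<tau> p)) summable_on UNIV"
    using **(1) by (simp add: case_prod_unfold triple_term_def)
  show "(triple_term z \<tau> has_sum (theta 0 (z - \<tau>) (3 * \<tau>) * (theta 0 z (3 * \<tau>) * theta 0 (z + \<tau>) (3 * \<tau>)))) UNIV"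
    using **(2) by (simp add: case_prod_unfold triple_term_def)
qed

definition cubic_sum :: "complex \<Rightarrow> complex" where
  "cubic_sum \<tau> = (\<Sum>\<^sub>\<infinity>(b, c). nome (of_int (3 * (b\<^sup>2 + b * c + c\<^sup>2) + 4 * b + 5 * c + 2) * \<tau>))"

text \<open>
  Group the triple series by \<open>a + b + c\<close>: the cyclic shift \<open>(a, b, c) \<mapsto> (c + 1, a, b)\<close> shows that
  the partial sums satisfy the recursion of the coefficients of \<open>\<theta>(z, \<tau>)\<close>.
\<close>
lemma theta_triple_product:
  assumes "Im \<tau> > 0"
  shows "(\<lambda>(b, c). nome (of_int (3 * (b\<^sup>2 + b * c + c\<^sup>2) + 4 * b + 5 * c + 2) * \<tau>)) summable_on UNIV"
    and "theta 0 (z - \<tau>) (3 * \<tau>) * (theta 0 z (3 * \<tau>) * theta 0 (z + \<tau>) (3 * \<tau>)) = cubic_sum \<tau> * theta 0 z \<tau>"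
proof -
  define P where "P = theta 0 (z - \<tau>) (3 * \<tau>) * (theta 0 z (3 * \<tau>) * theta 0 (z + \<tau>) (3 * \<tau>))"
  define t where "t = theta_term 0 z \<tau>"
  have t0: "t 0 \<noteq> 0" by (simp add: t_def theta_term_def)
  \<comment> \<open>The offset is fixed by the power of \<open>nome z\<close>: for
    \<open>a + b + c = M - 1\<close> the three half-integers add up to \<open>shift_half M\<close>,
    so the block \<open>M\<close> belongs to the term \<open>t M\<close>.\<close>
  define G where "G = (\<lambda>(M, b, c). triple_term z \<tau> (M - 1 - b - c, b, c))"
  have "(G has_sum P) UNIV"
    unfolding P_def G_def
    by (subst has_sum_reindex_bij_witness[where T = UNIV and h = "triple_term z \<tau>"
          and j = "\<lambda>(M, b, c). (M - 1 - b - c, b, c)" and i = "\<lambda>(a, b, c). (a + b + c + 1, b, c)"])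
       (use abs_summable_triple_term(2)[OF assms] in auto)
  then have G: "(G has_sum P) (Sigma UNIV (\<lambda>_. UNIV))" by simp
  define S where "S = (\<lambda>M. \<Sum>\<^sub>\<infinity>p. G (M, p))"
  have sG: "(\<lambda>p. G (M, p)) summable_on UNIV" for M
  proof (rule summable_on_SigmaD1[of "\<lambda>x y. G (x, y)" UNIV "\<lambda>_. UNIV" M])
    show "(\<lambda>(x, y). G (x, y)) summable_on UNIV \<times> UNIV"
      using G by (auto simp: summable_on_def case_prod_unfold)
  qed simp
  then have S: "((\<lambda>p. G (M, p)) has_sum S M) UNIV" for M unfolding S_def by (rule has_sum_infsum)
  have SP: "(S has_sum P) UNIV" by (rule has_sum_SigmaD[OF G]) (rule S)
  have S_Suc: "S (M + 1) = - nome z * nome \<tau> powi (M + 1) * S M" for M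
  proof -
    have "((\<lambda>p. - nome z * nome \<tau> powi (M + 1) * G (M, p)) has_sum (- nome z * nome \<tau> powi (M + 1) * S M)) UNIV"
      by (intro has_sum_cmult_right S)
    then have "((\<lambda>p. G (M + 1, p)) has_sum (- nome z * nome \<tau> powi (M + 1) * S M)) UNIV"
    proof (subst has_sum_reindex_bij_witness[where T = UNIV and h = "\<lambda>p. - nome z * nome \<tau> powi (M + 1) * G (M, p)"
          and i = "\<lambda>(b, c). (M - 1 - b - c, b)" and j = "\<lambda>(b, c). (c, M - 1 - b - c)"])
      show "- nome z * nome \<tau> powi (M + 1) * G (M, case p of (b, c) \<Rightarrow> (c, M - 1 - b - c)) = G (M + 1, p)" for p
      proof (cases p)
        case (Pair b c)
        have "triple_term z \<tau> ((M - 1 - b - c) + 1, b, c) = - nome z * nome (of_int (M + 1) * \<tau>) * triple_term z \<tau> (b, c, M - 1 - b - c)"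
          using triple_term_shift[of z \<tau> "M - 1 - b - c" b c] by (simp add: add.commute)
        moreover have "(M - 1 - b - c) + 1 = M + 1 - 1 - b - c" "M - 1 - c - (M - 1 - b - c) = b" by simp_all
        ultimately show ?thesis by (simp only: G_def Pair prod.case nome_of_int_mult)
      qed
    qed auto
    with S[of "M + 1"] show ?thesis by (rule has_sum_unique)
  qed
  have proportional: "S M * t 0 = t M * S 0" for M
  proof (induction M rule: int_induct[where k = 0])
    case (step1 i)
    then show ?case unfolding S_Suc t_def theta_term_0_Suc by algebra
  next
    case (step2 i)
    have "- nome z * nome \<tau> powi i * (S (i - 1) * t 0) = - nome z * nome \<tau> powi i * (t (i - 1) * S 0)"
      using step2.IH S_Suc[of "i - 1"] theta_term_0_Suc[of z \<tau> "i - 1"] unfolding t_def by (simp add: algebra_simps)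
    then show ?case by simp
  qed simp
  have "((\<lambda>M. S M * t 0) has_sum (P * t 0)) UNIV" by (rule has_sum_cmult_left[OF SP])
  moreover have "((\<lambda>M. t M * S 0) has_sum (theta 0 z \<tau> * S 0)) UNIV"
    unfolding t_def by (intro has_sum_cmult_left has_sum_theta assms)
  ultimately have *: "P * t 0 = theta 0 z \<tau> * S 0" unfolding proportional by (rule has_sum_unique)
  have G0: "G (0, p) = t 0 * (\<lambda>(b, c). nome (of_int (3 * (b\<^sup>2 + b * c + c\<^sup>2) + 4 * b + 5 * c + 2) * \<tau>)) p" for p
    using triple_term_sum_half[of z \<tau> "fst p" "snd p"] by (simp add: G_def t_def case_prod_unfold)
  then show "(\<lambda>(b, c). nome (of_int (3 * (b\<^sup>2 + b * c + c\<^sup>2) + 4 * b + 5 * c + 2) * \<tau>)) summable_on UNIV"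
    using sG[of 0] t0 by (simp add: summable_on_cmult_right')
  have "S 0 = t 0 * cubic_sum \<tau>"
    unfolding S_def G0 cubic_sum_def by (rule infsum_cmult_right')
  with * t0 show "theta 0 (z - \<tau>) (3 * \<tau>) * (theta 0 z (3 * \<tau>) * theta 0 (z + \<tau>) (3 * \<tau>)) = cubic_sum \<tau> * theta 0 z \<tau>"
    by (simp add: P_def)
qed

section \<open>The eta product of the cubic theta function\<close>

lemma qprod_trisect:
  assumes "norm q < 1" "q \<noteq> 0"
  shows "qprod y q = qprod (y / q\<^sup>2) (q ^ 3) * qprod (y / q) (q ^ 3) * qprod y (q ^ 3)"
proof (rule LIMSEQ_unique)
  have q3: "norm (q ^ 3) < 1" using assms by (simp add: norm_power power_less_one_iff)
  have "filterlim (\<lambda>n::nat. 3 * n) sequentially sequentially"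
    by (rule filterlim_subseq) (auto simp: strict_mono_def)
  then show "(\<lambda>N. \<Prod>n<3 * N. 1 - y * q ^ Suc n) \<longlonglongrightarrow> qprod y q"
    by (rule filterlim_compose[OF qprod_LIMSEQ[OF assms(1)]])
  have *: "(\<Prod>n<3 * N. f n) = (\<Prod>n<N. f (3 * n)) * (\<Prod>n<N. f (3 * n + 1)) * (\<Prod>n<N. f (3 * n + 2))"
    for f :: "nat \<Rightarrow> complex" and N
  proof (induction N)
    case (Suc N)
    have "3 * Suc N = Suc (Suc (Suc (3 * N)))" by simp
    then show ?case using Suc.IH by (simp only: prod.lessThan_Suc) (simp add: mult_ac)
  qed simp
  \<comment> \<open>Exponents are sorted modulo 3. The divisions by \<open>q\<^sup>2\<close> and
    \<open>q\<close> compensate for the powers of \<open>q ^ 3\<close> starting at exponent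
    1.\<close>
  have "1 - y * q ^ Suc (3 * n) = 1 - y / q\<^sup>2 * (q ^ 3) ^ Suc n"
    "1 - y * q ^ Suc (3 * n + 1) = 1 - y / q * (q ^ 3) ^ Suc n"
    "1 - y * q ^ Suc (3 * n + 2) = 1 - y * (q ^ 3) ^ Suc n" for n
    using assms by (simp_all add: power_mult power2_eq_square power3_eq_cube field_simps)
  then show "(\<lambda>N. \<Prod>n<3 * N. 1 - y * q ^ Suc n) \<longlonglongrightarrow> qprod (y / q\<^sup>2) (q ^ 3) * qprod (y / q) (q ^ 3) * qprod y (q ^ 3)"
    unfolding * by (simp only:) (intro tendsto_mult qprod_LIMSEQ q3)
qed

lemma qprod_shift:
  assumes "norm q < 1"
  shows "qprod y q = (1 - y * q) * qprod (y * q) q"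
proof (rule LIMSEQ_unique)
  show "(\<lambda>N. \<Prod>n<Suc N. 1 - y * q ^ Suc n) \<longlonglongrightarrow> qprod y q"
    by (rule LIMSEQ_Suc[OF qprod_LIMSEQ[OF assms]])
  have "(\<lambda>N. (1 - y * q) * (\<Prod>n<N. 1 - y * q * q ^ Suc n)) \<longlonglongrightarrow> (1 - y * q) * qprod (y * q) q"
    by (intro tendsto_mult tendsto_const qprod_LIMSEQ assms)
  also have "(\<lambda>N. (1 - y * q) * (\<Prod>n<N. 1 - y * q * q ^ Suc n)) = (\<lambda>N. \<Prod>n<Suc N. 1 - y * q ^ Suc n)"
    by (subst prod.lessThan_Suc_shift) (simp add: mult.assoc)
  finally show "(\<lambda>N. \<Prod>n<Suc N. 1 - y * q ^ Suc n) \<longlonglongrightarrow> (1 - y * q) * qprod (y * q) q" .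
qed

text \<open>Since \<open>cubic_sum \<tau>\<close> does not depend on \<open>z\<close>, one value of
  \<open>z\<close> determines it. At z = 1/2 theta is nonzero, and because
  \<open>nome (1/2) = -1\<close> both sides contain the same products at -1, - q and - 1 / q, which
  cancel.\<close>

lemma cubic_sum_eq:
  assumes "Im \<tau> > 0"
  shows "cubic_sum \<tau> * qprod 1 (nome \<tau>) = qprod 1 (nome \<tau> ^ 3) ^ 3"
proof -
  define q where "q = nome \<tau>"
  define E3 where "E3 = qprod 1 (q ^ 3)"
  define U V W where "U = qprod (-1) (q ^ 3)" and "V = qprod (- q) (q ^ 3)" and "W = qprod (- 1 / q) (q ^ 3)"
  define t where "t = theta_term 0"
  have \<tau>: "Im (3 * \<tau>) > 0" using assms by simp
  have q: "norm q < 1" "q \<noteq> 0" by (simp_all add: q_def norm_nome assms)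
  have q3: "norm (q ^ 3) < 1" using q by (simp add: norm_power power_less_one_iff)
  have nq: "nome (3 * \<tau>) = q ^ 3" by (simp add: q_def nome_numeral_mult)
  have nh: "nome (1/2) = -1" "nome (- (1/2)) = -1" "nome (- 1/2) = -1" by (simp_all add: nome_def exp_minus)
  have n: "nome (1/2 + \<tau>) = - q" "nome (- (1/2 + \<tau>)) = - 1 / q" "nome (1/2 - \<tau>) = - 1 / q" "nome (- (1/2 - \<tau>)) = - q"
    using nome_add[of "1/2" \<tau>] nome_add[of "-1/2" "-\<tau>"] nome_add[of "1/2" "-\<tau>"] nome_add[of "-1/2" "\<tau>"]
    by (simp_all add: nh q_def nome_minus)
  have "1 + q \<noteq> 0"
  proof
    assume "1 + q = 0"
    then have "q = -1" by (simp add: add_eq_0_iff)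
    with q show False by simp
  qed
  \<comment> \<open>Trisection yields a product at \<open>- 1 / q\<^sup>2\<close>; one shift by
    \<open>q ^ 3\<close> turns it into \<open>V\<close> and produces the factor
    \<open>1 + q\<close>.\<close>
  have "- 1 / q\<^sup>2 * q ^ 3 = - q" using q by (simp add: power2_eq_square power3_eq_cube)
  then have "qprod (-1) q = (1 + q) * V * W * U"
    unfolding qprod_trisect[OF q, of "-1"] using qprod_shift[OF q3, of "- 1 / q\<^sup>2"] by (simp add: U_def V_def W_def)
  moreover have "theta 0 (1/2) \<tau> = t (1/2) \<tau> 0 * 2 * (qprod 1 q * qprod (-1) q * qprod (-1) q)"
    using jacobi_triple_product[OF assms, of "1/2"] by (simp add: t_def nh q_def)
  ultimately have th: "theta 0 (1/2) \<tau> = t (1/2) \<tau> 0 * 2 * qprod 1 q * ((1 + q) * V * W * U) ^ 2"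
    by (simp add: power2_eq_square)
  have "theta 0 (1/2 - \<tau>) (3 * \<tau>) = t (1/2 - \<tau>) (3 * \<tau>) 0 * (1 + q) * (E3 * W * V)"
    "theta 0 (1/2) (3 * \<tau>) = t (1/2) (3 * \<tau>) 0 * 2 * (E3 * U * U)"
    "theta 0 (1/2 + \<tau>) (3 * \<tau>) = t (1/2 + \<tau>) (3 * \<tau>) 0 * (1 + 1 / q) * (E3 * V * W)"
    unfolding jacobi_triple_product[OF \<tau>] n nq using nh by (simp_all add: t_def U_def V_def W_def E3_def)
  moreover have "t (1/2 - \<tau>) (3 * \<tau>) 0 * (t (1/2) (3 * \<tau>) 0 * t (1/2 + \<tau>) (3 * \<tau>) 0) = t (1/2) \<tau> 0 * q"
  proof -
    have "t (1/2 - \<tau>) (3 * \<tau>) 0 * (t (1/2) (3 * \<tau>) 0 * t (1/2 + \<tau>) (3 * \<tau>) 0) =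
        exp (of_real pi * \<i> * \<tau> * (1/2)\<^sup>2 + 2 * of_real pi * \<i> * (1/2) * (1/2 + 1/2) + (2 * of_real pi * \<i> * \<tau> + 2 * of_real pi * \<i>))"
      unfolding t_def theta_term_def shift_half_def power_0 mult_1 exp_add[symmetric]
      by (intro arg_cong[where f = exp]) (simp add: power2_eq_square field_simps)
    also have "\<dots> = t (1/2) \<tau> 0 * (q * exp (2 * of_real pi * \<i>))"
      by (simp only: exp_add t_def theta_term_def shift_half_def q_def nome_def) simp
    also have "exp (2 * of_real pi * \<i>) = 1" by (rule exp_two_pi_i)
    finally show ?thesis by simp
  qed
  ultimately have "theta 0 (1/2 - \<tau>) (3 * \<tau>) * (theta 0 (1/2) (3 * \<tau>) * theta 0 (1/2 + \<tau>) (3 * \<tau>))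
     = t (1/2) \<tau> 0 * q * ((1 + q) * 2 * (1 + 1 / q) * E3 ^ 3 * (U * V * W) ^ 2)"
    by algebra
  also have "\<dots> = t (1/2) \<tau> 0 * 2 * ((1 + q) ^ 2 * E3 ^ 3 * (U * V * W) ^ 2)"
    using q by (simp add: field_simps power2_eq_square)
  finally have "E3 ^ 3 * (t (1/2) \<tau> 0 * 2 * ((1 + q) * V * W * U) ^ 2) =
      cubic_sum \<tau> * qprod 1 q * (t (1/2) \<tau> 0 * 2 * ((1 + q) * V * W * U) ^ 2)"
    unfolding theta_triple_product(2)[OF assms] th by algebra
  moreover have "t (1/2) \<tau> 0 * 2 * ((1 + q) * V * W * U) ^ 2 \<noteq> 0"
  proof -
    have "theta 0 (1/2) \<tau> \<noteq> 0"
    proof (rule theta_nonzero[OF assms], unfold period_lattice_def, safe)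
      fix m n :: int assume *: "1/2 = of_int m + of_int n * \<tau>"
      then have "n = 0" using assms arg_cong[OF *, of Im] by simp
      with * have "Re (1/2) = of_int m" by (metis Re_complex_of_real add.right_neutral mult_zero_left of_int_0 of_real_of_int_eq)
      then have "2 * m = 1" by (simp add: field_simps)
      then show False by presburger
    qed
    then show ?thesis unfolding th by auto
  qed
  ultimately show ?thesis by (simp add: q_def E3_def)
qed

text \<open>
  The symmetry \<open>(m, n) \<mapsto> (n, -1 - m - n)\<close> of the quadratic form permutes the three classes
  of \<open>n - m\<close> modulo 3, and each class contributes one copy of \<open>cubic_sum\<close>.
\<close>
lemma cubic_theta_c_cubic_sum:
  assumes "Im \<tau> > 0"
  shows "cubic_theta_c \<tau> = 3 * nome (\<tau> / 3) * cubic_sum \<tau>"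
proof -
  define e where "e = (\<lambda>(b::int, c::int). 3 * (b\<^sup>2 + b * c + c\<^sup>2) + 4 * b + 5 * c + 2)"
  define g where "g = (\<lambda>(m::int, n::int). m\<^sup>2 + m * n + n\<^sup>2 + m + n)"
  define f where "f = (\<lambda>p. nome (of_int (g p) * \<tau>))"
  define C where "C r = {(m::int, n). (n - m) mod 3 = r}" for r
  have s: "((\<lambda>p. nome (of_int (e p) * \<tau>)) has_sum cubic_sum \<tau>) UNIV"
    using has_sum_infsum[OF theta_triple_product(1)[OF assms]] by (simp add: e_def cubic_sum_def case_prod_unfold)
  have reindex: "(f has_sum cubic_sum \<tau>) (C r)"
    if "inj j" and surj: "\<And>m n k. n = m + 3 * k + r \<Longrightarrow> \<exists>b c. (m, n) = j (b, c)"
      and into: "\<And>b c. j (b, c) \<in> C r" and "\<And>b c. g (j (b, c)) = e (b, c)" for j r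
  proof -
    have "range j = C r"
    proof safe
      fix m n assume "(m, n) \<in> C r"
      then have "n = m + 3 * ((n - m) div 3) + r" by (auto simp: C_def)
      from surj[OF this] show "(m, n) \<in> range j" by blast
    qed (use into in auto)
    then have "bij_betw j UNIV (C r)" using that(1) by (simp add: bij_betw_def)
    moreover have "f (j p) = nome (of_int (e p) * \<tau>)" for p using that(4) by (cases p) (simp add: f_def)
    ultimately show ?thesis using s has_sum_reindex_bij_betw[of j UNIV "C r" f] by simp
  qed
  have "(f has_sum cubic_sum \<tau>) (C 0)"
  \<comment> \<open>The linear part has determinant 3 and multiplies m^2 + m n + n^2 by 3, like
    multiplication by sqrt (-3) in the Eisenstein integers; the translation adjusts the linear
    terms. Applying the symmetry once gives the substitution for \<open>C 2\<close>, applying it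
    twice the one for \<open>C 1\<close>.\<close>
  proof (rule reindex[of "\<lambda>(b, c). (- b - 2 * c - 2, 2 * b + c + 1)"])
    show "\<exists>b c. (m, n) = (case (b, c) of (b, c) \<Rightarrow> (- b - 2 * c - 2, 2 * b + c + 1))" if "n = m + 3 * k + 0" for m n k :: int
      by (rule exI[of _ "m + 2 * k"], rule exI[of _ "- m - k - 1"]) (simp add: that)
    show "(case (b, c) of (b, c) \<Rightarrow> (- b - 2 * c - 2, 2 * b + c + 1)) \<in> C 0" for b c by (simp add: C_def; presburger)
  qed (auto simp: inj_on_def g_def e_def power2_eq_square algebra_simps)
  moreover have "(f has_sum cubic_sum \<tau>) (C 1)"
  proof (rule reindex[of "\<lambda>(b, c). (c - b, - b - 2 * c - 2)"])
    show "\<exists>b c. (m, n) = (case (b, c) of (b, c) \<Rightarrow> (c - b, - b - 2 * c - 2))" if "n = m + 3 * k + 1" for m n k :: int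
      by (rule exI[of _ "- k - 1 - m"], rule exI[of _ "- k - 1"]) (simp add: that)
    show "(case (b, c) of (b, c) \<Rightarrow> (c - b, - b - 2 * c - 2)) \<in> C 1" for b c by (simp add: C_def; presburger)
  qed (auto simp: inj_on_def g_def e_def power2_eq_square algebra_simps)
  moreover have "(f has_sum cubic_sum \<tau>) (C 2)"
  proof (rule reindex[of "\<lambda>(b, c). (2 * b + c + 1, c - b)"])
    show "\<exists>b c. (m, n) = (case (b, c) of (b, c) \<Rightarrow> (2 * b + c + 1, c - b))" if "n = m + 3 * k + 2" for m n k :: int
      by (rule exI[of _ "- k - 1"], rule exI[of _ "m + 2 * k + 1"]) (simp add: that)
    show "(case (b, c) of (b, c) \<Rightarrow> (2 * b + c + 1, c - b)) \<in> C 2" for b c by (simp add: C_def; presburger)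
  qed (auto simp: inj_on_def g_def e_def power2_eq_square algebra_simps)
  ultimately have "(f has_sum (cubic_sum \<tau> + (cubic_sum \<tau> + cubic_sum \<tau>))) (C 0 \<union> (C 1 \<union> C 2))"
    by (intro has_sum_Un_disjoint) (auto simp: C_def)
  moreover have "(n - m) mod 3 = 0 \<or> (n - m) mod 3 = 1 \<or> (n - m) mod 3 = 2" for m n :: int by presburger
  then have "C 0 \<union> (C 1 \<union> C 2) = UNIV" by (auto simp: C_def)
  ultimately have "(f has_sum (3 * cubic_sum \<tau>)) UNIV" by simp
  then have "((\<lambda>p. nome (\<tau> / 3) * f p) has_sum (nome (\<tau> / 3) * (3 * cubic_sum \<tau>))) UNIV"
    by (rule has_sum_cmult_right)
  moreover have "nome (\<tau> / 3) * f p = (case p of (m, n) \<Rightarrow>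
      q_power \<tau> ((of_int n + 1/3)\<^sup>2 + (of_int n + 1/3) * (of_int m + 1/3) + (of_int m + 1/3)\<^sup>2))" for p
  proof (cases p)
    case (Pair m n)
    have "of_rat ((of_int n + 1/3)\<^sup>2 + (of_int n + 1/3) * (of_int m + 1/3) + (of_int m + 1/3)\<^sup>2)
       = (of_int n + 1/3)\<^sup>2 + (of_int n + 1/3) * (of_int m + 1/3) + (of_int m + 1/3 :: complex)\<^sup>2"
      by (simp add: of_rat_add of_rat_mult of_rat_power of_rat_divide)
    then have "q_power \<tau> ((of_int n + 1/3)\<^sup>2 + (of_int n + 1/3) * (of_int m + 1/3) + (of_int m + 1/3)\<^sup>2)
       = nome (((of_int n + 1/3)\<^sup>2 + (of_int n + 1/3) * (of_int m + 1/3) + (of_int m + 1/3 :: complex)\<^sup>2) * \<tau>)"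
      by (simp only: q_power_def nome_def mult.assoc)
    also have "((of_int n + 1/3)\<^sup>2 + (of_int n + 1/3) * (of_int m + 1/3) + (of_int m + 1/3 :: complex)\<^sup>2) * \<tau>
       = \<tau> / 3 + of_int (m\<^sup>2 + m * n + n\<^sup>2 + m + n) * \<tau>"
      by (simp add: power2_eq_square field_simps)
    finally show ?thesis by (simp only: Pair prod.case nome_add f_def g_def)
  qed
  ultimately show ?thesis unfolding cubic_theta_c_def by (simp add: has_sum_iff mult_ac)
qed

text \<open>The Borweins' product for c; the powers of the nome balance because 9/24 = 1/3 +
  1/24.\<close>

lemma cubic_theta_c_eta:
  assumes "Im \<tau> > 0"
  shows "cubic_theta_c \<tau> * dedekind_eta \<tau> = 3 * dedekind_eta (3 * \<tau>) ^ 3"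
proof -
  have "nome (3 * \<tau> / 24) ^ 3 = nome (\<tau> / 3) * nome (\<tau> / 24)"
    unfolding nome_of_nat_mult[symmetric] nome_add[symmetric] by simp
  then show ?thesis
    using cubic_sum_eq[OF assms]
    unfolding cubic_theta_c_cubic_sum[OF assms] dedekind_eta_eq nome_numeral_mult by algebra
qed

section \<open>Theta functions of order two\<close>

text \<open>As the zeros of \<open>H\<close> are simple, l'Hopital's value
  \<open>G' z / H' z\<close> fills the singularity, and it is enough that \<open>G\<close> vanishes
  there too.\<close>

lemma removable_quotient:
  fixes G H G' H' :: "complex \<Rightarrow> complex"
  assumes G: "\<And>z. (G has_field_derivative G' z) (at z)" and H: "\<And>z. (H has_field_derivative H' z) (at z)"
    and zero: "\<And>z. H z = 0 \<Longrightarrow> G z = 0 \<and> H' z \<noteq> 0"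
  obtains g where "g holomorphic_on UNIV" "\<And>z. G z = g z * H z"
proof -
  define g where "g = (\<lambda>z. if H z = 0 then G' z / H' z else G z / H z)"
  have hG: "G holomorphic_on S" and hH: "H holomorphic_on S" for S
    using G H by (auto simp: holomorphic_on_def field_differentiable_def intro: has_field_derivative_at_within)
  have "(\<lambda>z. G z / H z) holomorphic_on {z. H z \<noteq> 0}" by (intro holomorphic_on_divide hG hH) simp
  then have nonzero: "g holomorphic_on {z. H z \<noteq> 0}"
    by (rule holomorphic_transform) (simp add: g_def)
  have "continuous_on UNIV H" by (rule holomorphic_on_imp_continuous_on[OF hH])
  then have op: "open {z. H z \<noteq> 0}" by (intro open_Collect_neq continuous_on_const)
  have "g field_differentiable at z" for z
  proof (cases "H z = 0")
    case False
    then show ?thesis using holomorphic_on_imp_differentiable_at[OF nonzero op] by simp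
  next
    case True
    have H1: "(\<lambda>w. (H w - H z) / (w - z)) \<midarrow>z\<rightarrow> H' z" and G1: "(\<lambda>w. (G w - G z) / (w - z)) \<midarrow>z\<rightarrow> G' z"
      using G H by (simp_all add: has_field_derivative_iff)
    have "\<forall>\<^sub>F w in at z. (H w - H z) / (w - z) \<noteq> 0"
      using tendsto_imp_eventually_ne[OF H1] zero[OF True] by blast
    then have ev: "\<forall>\<^sub>F w in at z. H w \<noteq> 0" by eventually_elim (use True in auto)
    then obtain r where r: "r > 0" "\<And>w. w \<noteq> z \<Longrightarrow> dist w z < r \<Longrightarrow> H w \<noteq> 0" by (auto simp: eventually_at)
    have "((\<lambda>w. ((G w - G z) / (w - z)) / ((H w - H z) / (w - z))) \<longlongrightarrow> G' z / H' z) (at z)"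
      using zero[OF True] by (intro tendsto_divide G1 H1) auto
    moreover have "\<forall>\<^sub>F w in at z. ((G w - G z) / (w - z)) / ((H w - H z) / (w - z)) = g w"
      using ev eventually_neq_at_within[of z z] by eventually_elim (use True zero[OF True] in \<open>auto simp: g_def\<close>)
    ultimately have "(g \<longlongrightarrow> G' z / H' z) (at z)" by (rule Lim_transform_eventually)
    then have "(g \<longlongrightarrow> g z) (at z)" using True by (simp add: g_def)
    then have lim: "(g \<longlongrightarrow> g z) (at z within ball z r)" by (rule tendsto_within_subset) simp
    have "g holomorphic_on ball z r"
    proof (rule no_isolated_singularity')
      show "g holomorphic_on ball z r - {z}"
        by (rule holomorphic_on_subset[OF nonzero]) (use r in \<open>auto simp: dist_commute\<close>)
    qed (use lim in auto)
    with r(1) show ?thesis by (intro holomorphic_on_imp_differentiable_at[of g "ball z r"]) auto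
  qed
  then have "g holomorphic_on UNIV" by (simp add: holomorphic_on_def)
  moreover have "G z = g z * H z" for z using zero[of z] by (auto simp: g_def)
  ultimately show ?thesis by (rule that)
qed

text \<open>At a simple zero of \<open>H\<close> the derivative of the product is
  \<open>H' z * k z\<close>. This carries periodicity of the quotient \<open>G / H\<close> across
  the zeros of \<open>H\<close>.\<close>

lemma holomorphic_zero_of_mult_zero:
  fixes k H H' :: "complex \<Rightarrow> complex"
  assumes k: "k holomorphic_on UNIV" and H: "\<And>z. (H has_field_derivative H' z) (at z)"
    and zero: "\<And>z. H z = 0 \<Longrightarrow> H' z \<noteq> 0" and prod: "\<And>z. k z * H z = 0"
  shows "k z = 0"
proof (cases "H z = 0")
  case True
  have "(k has_field_derivative deriv k z) (at z)" using k by (rule holomorphic_derivI) auto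
  then have "((\<lambda>z. k z * H z) has_field_derivative deriv k z * H z + H' z * k z) (at z)"
    by (rule DERIV_mult[OF _ H])
  moreover have "((\<lambda>z. k z * H z) has_field_derivative 0) (at z)" unfolding prod by simp
  ultimately have "deriv k z * H z + H' z * k z = 0" by (rule DERIV_unique)
  with True zero[OF True] show ?thesis by simp
qed (use prod[of z] in simp)

lemma doubly_periodic_entire_constant:
  assumes \<tau>: "Im \<tau> > 0" and g: "g holomorphic_on UNIV"
    and p1: "\<And>z. g (z + 1) = g z" and p2: "\<And>z. g (z + \<tau>) = g z"
  shows "\<exists>K. \<forall>z. g z = K"
proof -
  have m: "g (z + of_int m) = g z" for z m
  proof (induction m rule: int_induct[where k = 0])
    case (step1 i) then show ?case using p1[of "z + of_int i"] by (simp add: add_ac)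
  next
    case (step2 i) then show ?case using p1[of "z + of_int (i - 1)"] by (simp add: algebra_simps)
  qed simp
  have n: "g (z + of_int n * \<tau>) = g z" for z n
  proof (induction n rule: int_induct[where k = 0])
    case (step1 i) then show ?case using p2[of "z + of_int i * \<tau>"] by (simp add: algebra_simps)
  next
    case (step2 i) then show ?case using p2[of "z + of_int (i - 1) * \<tau>"] by (simp add: algebra_simps)
  qed simp
  define Q where "Q = (\<lambda>(s, t). of_real s + of_real t * \<tau>) ` ({0..1} \<times> {0..1::real})"
  have "compact Q"
    unfolding Q_def by (intro compact_continuous_image compact_Times compact_Icc)
      (auto simp: case_prod_unfold intro!: continuous_intros)
  then have "compact (g ` Q)"
    using g by (intro compact_continuous_image holomorphic_on_imp_continuous_on) (auto intro: holomorphic_on_subset)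
  have "g z \<in> g ` Q" for z
  proof -
    define t where "t = Im z / Im \<tau>"
    define s where "s = Re z - t * Re \<tau>"
    have z: "z = of_real s + of_real t * \<tau>"
      using \<tau> by (simp add: complex_eq_iff s_def t_def)
    have "z = (of_real (frac s) + of_real (frac t) * \<tau>) + of_int \<lfloor>s\<rfloor> + of_int \<lfloor>t\<rfloor> * \<tau>"
      by (subst z) (simp add: frac_def algebra_simps)
    then have "g z = g (of_real (frac s) + of_real (frac t) * \<tau>)" by (metis m n)
    moreover have "of_real (frac s) + of_real (frac t) * \<tau> \<in> Q"
      unfolding Q_def by (intro image_eqI[of _ _ "(frac s, frac t)"]) (auto intro: less_imp_le[OF frac_lt_1])
    ultimately show ?thesis by blast
  qed
  then have "range g \<subseteq> g ` Q" by blast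
  with \<open>compact (g ` Q)\<close> have "bounded (range g)" by (meson bounded_subset compact_imp_bounded)
  from Liouville_theorem[OF g this] show ?thesis by (auto simp: constant_on_def)
qed

text \<open>The simple zero at 0, where the derivative is a multiple of eta^3, is propagated by the
  two periods: at a zero, the extra summand in the transformation of \<open>theta 1\<close> drops
  out.\<close>

lemma theta_lattice_zeros:
  assumes "Im \<tau> > 0" "z \<in> period_lattice \<tau>"
  shows "theta 0 z \<tau> = 0" "theta 1 z \<tau> \<noteq> 0"
proof -
  define P where "P z \<longleftrightarrow> theta 0 z \<tau> = 0 \<and> theta 1 z \<tau> \<noteq> 0" for z
  have 1: "P (z + 1) \<longleftrightarrow> P z" for z by (simp add: P_def theta_plus_1)
  have 2: "P (z + \<tau>) \<longleftrightarrow> P z" for z by (auto simp: P_def theta_plus_tau[OF assms(1)] simp del: One_nat_def)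
  have "P 0" using assms by (simp add: P_def theta_0_0 theta_1_0 dedekind_eta_nonzero del: One_nat_def)
  have m: "P (of_int m)" for m
  proof (induction m rule: int_induct[where k = 0])
    case (step1 i) then show ?case using 1[of "of_int i"] by (simp add: add_ac)
  next
    case (step2 i) then show ?case using 1[of "of_int (i - 1)"] by simp
  qed (simp add: \<open>P 0\<close>)
  have n: "P (of_int m + of_int n * \<tau>)" for m n
  proof (induction n rule: int_induct[where k = 0])
    case (step1 i) then show ?case using 2[of "of_int m + of_int i * \<tau>"] by (simp add: algebra_simps)
  next
    case (step2 i) then show ?case using 2[of "of_int m + of_int (i - 1) * \<tau>"] by (simp add: algebra_simps)
  qed (simp add: m)
  then have "P z" using assms(2) unfolding period_lattice_def by blast
  then show "theta 0 z \<tau> = 0" "theta 1 z \<tau> \<noteq> 0" by (simp_all add: P_def)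
qed

lemma theta_eq_0_iff: "Im \<tau> > 0 \<Longrightarrow> theta 0 z \<tau> = 0 \<longleftrightarrow> z \<in> period_lattice \<tau>"
  using theta_nonzero theta_lattice_zeros by blast

lemma period_lattice_diff:
  assumes "x \<in> period_lattice \<tau>" "y \<in> period_lattice \<tau>"
  shows "x - y \<in> period_lattice \<tau>"
proof -
  obtain m n m' n' :: int where "x = of_int m + of_int n * \<tau>" "y = of_int m' + of_int n' * \<tau>"
    using assms unfolding period_lattice_def by blast
  then have "x - y = of_int (m - m') + of_int (n - n') * \<tau>" by (simp add: algebra_simps)
  then show ?thesis unfolding period_lattice_def by blast
qed

text \<open>By quasi-periodicity \<open>G\<close> vanishes at all zeros of the product of thetas,
  and these are simple because the translates of the lattice by \<open>- a\<close> and
  \<open>- b\<close> are disjoint. The quotient is then entire with both periods, hence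
  constant.\<close>

lemma theta_quadratic_space:
  fixes G G' :: "complex \<Rightarrow> complex"
  assumes \<tau>: "Im \<tau> > 0" and ab: "a - b \<notin> period_lattice \<tau>"
    and G: "\<And>u. (G has_field_derivative G' u) (at u)"
    and p1: "\<And>u. G (u + 1) = G u"
    and p2: "\<And>u. G (u + \<tau>) = theta_multiplier (u + a) \<tau> * theta_multiplier (u + b) \<tau> * G u"
    and za: "G (- a) = 0" and zb: "G (- b) = 0"
  shows "\<exists>K. \<forall>u. G u = K * (theta 0 (u + a) \<tau> * theta 0 (u + b) \<tau>)"
proof -
  define H where "H = (\<lambda>u. theta 0 (u + a) \<tau> * theta 0 (u + b) \<tau>)"
  define H' where "H' = (\<lambda>u. 2 * of_real pi * \<i> * (theta 1 (u + a) \<tau> * theta 0 (u + b) \<tau> + theta 0 (u + a) \<tau> * theta 1 (u + b) \<tau>))"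
  have H: "(H has_field_derivative H' u) (at u)" for u
  proof -
    have d: "((\<lambda>u. theta 0 (u + c) \<tau>) has_field_derivative 2 * of_real pi * \<i> * theta 1 (u + c) \<tau>) (at u)" for c
      using DERIV_theta_z[OF \<tau>, of 0 "u + c"] unfolding One_nat_def DERIV_shift .
    show ?thesis
      unfolding H_def H'_def
      by (rule DERIV_cong[OF DERIV_mult[OF d d]]) (simp add: algebra_simps)
  qed
  have G0: "G (z + of_int m + of_int n * \<tau>) = 0" if "G z = 0" for z m n
  proof -
    have m: "G (z + of_int m) = 0"
    proof (induction m rule: int_induct[where k = 0])
      case (step1 i) then show ?case using p1[of "z + of_int i"] by (simp add: add_ac)
    next
      case (step2 i) then show ?case using p1[of "z + of_int (i - 1)"] by (simp add: algebra_simps)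
    qed (simp add: that)
    show ?thesis
    proof (induction n rule: int_induct[where k = 0])
      case (step1 i) then show ?case using p2[of "z + of_int m + of_int i * \<tau>"] by (simp add: algebra_simps)
    next
      case (step2 i) then show ?case using p2[of "z + of_int m + of_int (i - 1) * \<tau>"] by (simp add: algebra_simps)
    qed (simp add: m)
  qed
  have lat: "G u = 0" if u: "u + c \<in> period_lattice \<tau>" and c: "G (- c) = 0" for u c
  proof -
    obtain m n :: int where "u + c = of_int m + of_int n * \<tau>" using u unfolding period_lattice_def by blast
    then have "u = - c + of_int m + of_int n * \<tau>" by (simp add: algebra_simps)
    then show ?thesis using G0[OF c] by simp
  qed
  have zero: "G u = 0 \<and> H' u \<noteq> 0" if Hu: "H u = 0" for u
  proof -
    have d: "\<not> (u + a \<in> period_lattice \<tau> \<and> u + b \<in> period_lattice \<tau>)"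
      using ab period_lattice_diff[of "u + a" \<tau> "u + b"] by auto
    consider "u + a \<in> period_lattice \<tau>" | "u + b \<in> period_lattice \<tau>"
      using Hu by (auto simp: H_def theta_eq_0_iff[OF \<tau>])
    then show ?thesis
    proof cases
      case 1
      then show ?thesis using d lat[OF 1 za] theta_lattice_zeros[OF \<tau> 1] theta_eq_0_iff[OF \<tau>, of "u + b"]
        by (simp add: H'_def)
    next
      case 2
      then show ?thesis using d lat[OF 2 zb] theta_lattice_zeros[OF \<tau> 2] theta_eq_0_iff[OF \<tau>, of "u + a"]
        by (simp add: H'_def)
    qed
  qed
  obtain g where g: "g holomorphic_on UNIV" "\<And>z. G z = g z * H z"
    using removable_quotient[OF G H zero] by blast
  have H1: "H (u + 1) = H u" for u
    using theta_plus_1[of 0 "u + a" \<tau>] theta_plus_1[of 0 "u + b" \<tau>] by (simp add: H_def add_ac)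
  have H2: "H (u + \<tau>) = theta_multiplier (u + a) \<tau> * theta_multiplier (u + b) \<tau> * H u" for u
    using theta_plus_tau(1)[OF \<tau>, of "u + a"] theta_plus_tau(1)[OF \<tau>, of "u + b"] by (simp add: H_def add_ac)
  have shift: "(\<lambda>z. g (z + c)) holomorphic_on UNIV" for c
  proof -
    have "g \<circ> (\<lambda>z. z + c) holomorphic_on UNIV"
      by (rule holomorphic_on_compose) (auto intro!: holomorphic_intros holomorphic_on_subset[OF g(1)])
    then show ?thesis by (simp add: o_def)
  qed
  have "g (u + 1) - g u = 0" for u
  proof (rule holomorphic_zero_of_mult_zero[of "\<lambda>u. g (u + 1) - g u", OF _ H])
    show "(g (z + 1) - g z) * H z = 0" for z using p1[of z] H1[of z] unfolding g(2) by (simp add: algebra_simps)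
  qed (use zero in \<open>auto intro!: holomorphic_on_diff shift g(1)\<close>)
  moreover have "g (u + \<tau>) - g u = 0" for u
  proof (rule holomorphic_zero_of_mult_zero[of "\<lambda>u. g (u + \<tau>) - g u", OF _ H])
    show "(g (z + \<tau>) - g z) * H z = 0" for z using p2[of z] H2[of z] unfolding g(2) by (simp add: algebra_simps)
  qed (use zero in \<open>auto intro!: holomorphic_on_diff shift g(1)\<close>)
  ultimately obtain K where "\<And>z. g z = K"
    using doubly_periodic_entire_constant[OF \<tau> g(1)] by auto
  then show ?thesis using g(2) by (auto simp: H_def)
qed

section \<open>Addition theorems\<close>

lemma theta_multiplier_mult:
  "theta_multiplier x \<tau> * theta_multiplier y \<tau> = exp (- 2 * of_real pi * \<i> * (\<tau> + (x + y)))"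
  by (simp add: theta_multiplier_def algebra_simps flip: exp_add)

lemma DERIV_theta_shift:
  assumes "Im \<tau> > 0"
  shows "((\<lambda>u. theta k (u + c) \<tau>) has_field_derivative 2 * of_real pi * \<i> * theta (Suc k) (u + c) \<tau>) (at u)"
  using DERIV_theta_z[OF assms, of k "u + c"] unfolding DERIV_shift .

text \<open>The theta form of sigma(u + v) sigma(u - v) = - sigma(u)^2 sigma(v)^2 (p(u) - p(v)),
  with p the Weierstrass function. As a function of \<open>u\<close> the right-hand side has the
  multiplier of a square and vanishes at \<open>v\<close> and \<open>- v\<close>, which differ
  modulo periods; u = 0 gives the constant.\<close>

lemma theta_difference_product:
  assumes \<tau>: "Im \<tau> > 0" and v: "2 * v \<notin> period_lattice \<tau>"
  shows "theta 1 0 \<tau> ^ 2 * (theta 0 (u + v) \<tau> * theta 0 (u - v) \<tau>) =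
    (theta 2 u \<tau> * theta 0 u \<tau> - theta 1 u \<tau> ^ 2) * theta 0 v \<tau> ^ 2
    - theta 0 u \<tau> ^ 2 * (theta 2 v \<tau> * theta 0 v \<tau> - theta 1 v \<tau> ^ 2)"
proof -
  define B where "B k = theta k v \<tau>" for k
  define G where "G u = (theta 2 u \<tau> * theta 0 u \<tau> - theta 1 u \<tau> ^ 2) * B 0 ^ 2
    - theta 0 u \<tau> ^ 2 * (B 2 * B 0 - B 1 ^ 2)" for u
  define G' where "G' u = 2 * of_real pi * \<i> * ((theta 3 u \<tau> * theta 0 u \<tau> - theta 1 u \<tau> * theta 2 u \<tau>) * B 0 ^ 2
    - 2 * theta 0 u \<tau> * theta 1 u \<tau> * (B 2 * B 0 - B 1 ^ 2))" for u
  have d: "((\<lambda>u. theta 0 u \<tau>) has_field_derivative 2 * of_real pi * \<i> * theta 1 u \<tau>) (at u)"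
    "((\<lambda>u. theta 1 u \<tau>) has_field_derivative 2 * of_real pi * \<i> * theta 2 u \<tau>) (at u)"
    "((\<lambda>u. theta 2 u \<tau>) has_field_derivative 2 * of_real pi * \<i> * theta 3 u \<tau>) (at u)" for u
    using DERIV_theta_z[OF \<tau>, of 0 u] DERIV_theta_z[OF \<tau>, of 1 u] DERIV_theta_z[OF \<tau>, of 2 u]
    by (simp_all add: numeral_2_eq_2 numeral_3_eq_3)
  have "(G has_field_derivative G' u) (at u)" for u
    unfolding G_def G'_def
    by (rule derivative_eq_intros d refl)+ (simp add: algebra_simps power2_eq_square)
  moreover have "G (u + 1) = G u" for u by (simp add: G_def theta_plus_1)
  moreover have "G (u + \<tau>) = theta_multiplier (u + v) \<tau> * theta_multiplier (u + - v) \<tau> * G u" for u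
  proof -
    have m: "theta_multiplier (u + v) \<tau> * theta_multiplier (u + - v) \<tau> = theta_multiplier u \<tau> ^ 2"
      by (simp add: theta_multiplier_mult power2_eq_square)
    show ?thesis unfolding m unfolding G_def theta_plus_tau[OF \<tau>] by algebra
  qed
  moreover have "G (- v) = 0" "G (- (- v)) = 0"
    by (simp_all add: G_def B_def theta_minus[OF \<tau>])
  moreover have "v - - v \<notin> period_lattice \<tau>" using v by simp
  ultimately have "\<exists>K. \<forall>u. G u = K * (theta 0 (u + v) \<tau> * theta 0 (u + - v) \<tau>)"
    by (intro theta_quadratic_space[OF \<tau>]) 
  then obtain K where K: "\<And>u. G u = K * (theta 0 (u + v) \<tau> * theta 0 (u - v) \<tau>)" by auto
  have "B 0 \<noteq> 0"
  proof
    assume "B 0 = 0"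
    then have "v \<in> period_lattice \<tau>" by (simp add: B_def theta_eq_0_iff[OF \<tau>])
    moreover have "0 \<in> period_lattice \<tau>" using theta_eq_0_iff[OF \<tau>, of 0] theta_0_0[OF \<tau>] by simp
    ultimately have "v - (0 - v) \<in> period_lattice \<tau>" by (intro period_lattice_diff)
    with v show False by simp
  qed
  moreover have "- (theta 1 0 \<tau> ^ 2) * B 0 ^ 2 = - K * B 0 ^ 2"
    using K[of 0] by (simp add: G_def B_def theta_0_0[OF \<tau>] theta_minus[OF \<tau>] power2_eq_square)
  ultimately have "K = theta 1 0 \<tau> ^ 2" by simp
  with K[of u] show ?thesis by (simp add: G_def B_def)
qed

text \<open>Divided by the three thetas on the right, the bracket is (s(u) + s(v) - s(u+v))^2 + d(u)
  + d(v) + d(u+v). The cleared form is entire in \<open>u\<close> and vanishes at 0 and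
  \<open>- v\<close>. Since both sides vanish at u = 0, the constant is read off from their
  derivatives there.\<close>

lemma theta_three_term:
  assumes \<tau>: "Im \<tau> > 0" and v: "v \<notin> period_lattice \<tau>"
  shows "theta 1 0 \<tau> * (theta 2 u \<tau> * theta 0 v \<tau> * theta 0 (u + v) \<tau> + theta 0 u \<tau> * theta 2 v \<tau> * theta 0 (u + v) \<tau>
      + theta 0 u \<tau> * theta 0 v \<tau> * theta 2 (u + v) \<tau> + 2 * theta 1 u \<tau> * theta 1 v \<tau> * theta 0 (u + v) \<tau>
      - 2 * theta 1 u \<tau> * theta 0 v \<tau> * theta 1 (u + v) \<tau> - 2 * theta 0 u \<tau> * theta 1 v \<tau> * theta 1 (u + v) \<tau>)
    = theta 3 0 \<tau> * (theta 0 u \<tau> * theta 0 v \<tau> * theta 0 (u + v) \<tau>)"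
proof -
  define A where "A k u = theta k u \<tau>" for k u
  define C where "C k u = theta k (u + v) \<tau>" for k u
  define B where "B k = theta k v \<tau>" for k
  define G where "G u = A 2 u * B 0 * C 0 u + A 0 u * B 2 * C 0 u + A 0 u * B 0 * C 2 u + 2 * A 1 u * B 1 * C 0 u
     - 2 * A 1 u * B 0 * C 1 u - 2 * A 0 u * B 1 * C 1 u" for u
  define G' where "G' u = 2 * of_real pi * \<i> * (A 3 u * B 0 * C 0 u - A 2 u * B 0 * C 1 u + A 1 u * B 2 * C 0 u
     + A 0 u * B 2 * C 1 u - A 1 u * B 0 * C 2 u + A 0 u * B 0 * C 3 u + 2 * A 2 u * B 1 * C 0 u - 2 * A 0 u * B 1 * C 2 u)" for u
  have dA: "(A k has_field_derivative 2 * of_real pi * \<i> * A (Suc k) u) (at u)" for k u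
    unfolding A_def by (rule DERIV_theta_z[OF \<tau>])
  have dC: "(C k has_field_derivative 2 * of_real pi * \<i> * C (Suc k) u) (at u)" for k u
    unfolding C_def by (rule DERIV_theta_shift[OF \<tau>])
  have S: "Suc 0 = 1" "Suc 1 = 2" "Suc 2 = 3" by simp_all
  have G: "(G has_field_derivative G' u) (at u)" for u
    unfolding G_def G'_def
    by (rule derivative_eq_intros dA dC refl)+ (simp only: S, simp add: algebra_simps)
  have "\<exists>K. \<forall>u. G u = K * (theta 0 (u + 0) \<tau> * theta 0 (u + v) \<tau>)"
  proof (rule theta_quadratic_space[OF \<tau> _ G])
    have "0 \<in> period_lattice \<tau>" using theta_eq_0_iff[OF \<tau>, of 0] theta_0_0[OF \<tau>] by simp
    then show "0 - v \<notin> period_lattice \<tau>" using period_lattice_diff[of 0 \<tau> "0 - v"] v by auto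
    show "G (u + 1) = G u" for u
    proof -
      have "u + 1 + v = u + v + 1" by simp
      then show ?thesis unfolding G_def A_def C_def by (simp only: theta_plus_1) simp
    qed
    show "G (u + \<tau>) = theta_multiplier (u + 0) \<tau> * theta_multiplier (u + v) \<tau> * G u" for u
    proof -
      have e: "u + \<tau> + v = u + v + \<tau>" by simp
      show ?thesis
        unfolding G_def A_def C_def e theta_plus_tau[OF \<tau>] add_0_right by algebra
    qed
    show "G (- 0) = 0"
      using theta_minus[OF \<tau>, of 2 0] by (simp add: G_def A_def B_def C_def theta_0_0[OF \<tau>])
    show "G (- v) = 0"
      using theta_minus[OF \<tau>, of 2 0] by (simp add: G_def A_def B_def C_def theta_0_0[OF \<tau>] theta_minus[OF \<tau>])
  qed
  then obtain K where K: "\<And>u. G u = K * (A 0 u * C 0 u)" by (auto simp: A_def C_def)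
  have "((\<lambda>u. K * (A 0 u * C 0 u)) has_field_derivative
      K * (2 * of_real pi * \<i> * (A 1 0 * C 0 0 + A 0 0 * C 1 0))) (at 0)"
    by (rule derivative_eq_intros dA dC refl)+ (simp only: S, simp add: algebra_simps)
  moreover have "G = (\<lambda>u. K * (A 0 u * C 0 u))" using K by blast
  ultimately have "G' 0 = K * (2 * of_real pi * \<i> * (A 1 0 * C 0 0 + A 0 0 * C 1 0))"
    using G[of 0] DERIV_unique by metis
  moreover have "A 0 0 = 0" "A 2 0 = 0" "C k 0 = B k" for k
    using theta_minus[OF \<tau>, of 2 0] by (simp_all add: A_def B_def C_def theta_0_0[OF \<tau>])
  ultimately have "2 * of_real pi * \<i> * (A 3 0 * B 0 * B 0) = 2 * of_real pi * \<i> * (K * A 1 0 * B 0)"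
    by (simp add: G'_def algebra_simps)
  then have "A 3 0 * B 0 = K * A 1 0"
    using theta_nonzero[OF assms] by (simp add: B_def)
  then have "A 1 0 * G u = A 3 0 * (A 0 u * B 0 * C 0 u)" unfolding K by algebra
  then show ?thesis by (simp only: G_def A_def B_def C_def)
qed

section \<open>Logarithmic derivatives of theta\<close>

definition dlog1 :: "complex \<Rightarrow> complex \<Rightarrow> complex" where
  "dlog1 z \<tau> = theta 1 z \<tau> / theta 0 z \<tau>"

definition dlog2 :: "complex \<Rightarrow> complex \<Rightarrow> complex" where
  "dlog2 z \<tau> = theta 2 z \<tau> / theta 0 z \<tau> - dlog1 z \<tau> ^ 2"

text \<open>With theta k / theta 0 in the role of moments, the functions \<open>dlog1\<close> to
  \<open>dlog4\<close> are the cumulants; this is the origin of the coefficients here and in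
  \<open>dlog4\<close>.\<close>

definition dlog3 :: "complex \<Rightarrow> complex \<Rightarrow> complex" where
  "dlog3 z \<tau> = theta 3 z \<tau> / theta 0 z \<tau> - 3 * dlog1 z \<tau> * dlog2 z \<tau> - dlog1 z \<tau> ^ 3"

definition dlog4 :: "complex \<Rightarrow> complex \<Rightarrow> complex" where
  "dlog4 z \<tau> = theta 4 z \<tau> / theta 0 z \<tau> - 4 * dlog1 z \<tau> * dlog3 z \<tau> - 3 * dlog2 z \<tau> ^ 2
     - 6 * dlog1 z \<tau> ^ 2 * dlog2 z \<tau> - dlog1 z \<tau> ^ 4"

lemma DERIV_theta_ratio:
  assumes "Im \<tau> > 0" "theta 0 z \<tau> \<noteq> 0"
  shows "((\<lambda>z. theta k z \<tau> / theta 0 z \<tau>) has_field_derivative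
      2 * of_real pi * \<i> * (theta (Suc k) z \<tau> / theta 0 z \<tau> - theta k z \<tau> / theta 0 z \<tau> * dlog1 z \<tau>)) (at z)"
    and "((\<lambda>\<tau>. theta k z \<tau> / theta 0 z \<tau>) has_field_derivative
      of_real pi * \<i> * (theta (k + 2) z \<tau> / theta 0 z \<tau> - theta k z \<tau> / theta 0 z \<tau> * (theta 2 z \<tau> / theta 0 z \<tau>))) (at \<tau>)"
proof -
  show "((\<lambda>z. theta k z \<tau> / theta 0 z \<tau>) has_field_derivative
      2 * of_real pi * \<i> * (theta (Suc k) z \<tau> / theta 0 z \<tau> - theta k z \<tau> / theta 0 z \<tau> * dlog1 z \<tau>)) (at z)"
    by (rule DERIV_cong[OF DERIV_divide[OF DERIV_theta_z DERIV_theta_z]])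
       (use assms in \<open>simp_all add: dlog1_def field_simps\<close>)
  show "((\<lambda>\<tau>. theta k z \<tau> / theta 0 z \<tau>) has_field_derivative
      of_real pi * \<i> * (theta (k + 2) z \<tau> / theta 0 z \<tau> - theta k z \<tau> / theta 0 z \<tau> * (theta 2 z \<tau> / theta 0 z \<tau>))) (at \<tau>)"
    by (rule DERIV_cong[OF DERIV_divide[OF DERIV_theta_tau DERIV_theta_tau]])
       (use assms in \<open>simp_all add: numeral_2_eq_2 field_simps\<close>)
qed

lemma theta_ratio_dlog:
  "theta 1 z \<tau> / theta 0 z \<tau> = dlog1 z \<tau>"
  "theta 2 z \<tau> / theta 0 z \<tau> = dlog2 z \<tau> + dlog1 z \<tau> ^ 2"
  "theta 3 z \<tau> / theta 0 z \<tau> = dlog3 z \<tau> + 3 * dlog1 z \<tau> * dlog2 z \<tau> + dlog1 z \<tau> ^ 3"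
  "theta 4 z \<tau> / theta 0 z \<tau> = dlog4 z \<tau> + 4 * dlog1 z \<tau> * dlog3 z \<tau> + 3 * dlog2 z \<tau> ^ 2
     + 6 * dlog1 z \<tau> ^ 2 * dlog2 z \<tau> + dlog1 z \<tau> ^ 4"
  by (simp_all add: dlog1_def dlog2_def dlog3_def dlog4_def)

lemma DERIV_dlog_z:
  assumes "Im \<tau> > 0" "theta 0 z \<tau> \<noteq> 0"
  shows "((\<lambda>z. dlog1 z \<tau>) has_field_derivative 2 * of_real pi * \<i> * dlog2 z \<tau>) (at z)"
    and "((\<lambda>z. dlog2 z \<tau>) has_field_derivative 2 * of_real pi * \<i> * dlog3 z \<tau>) (at z)"
    and "((\<lambda>z. dlog3 z \<tau>) has_field_derivative 2 * of_real pi * \<i> * dlog4 z \<tau>) (at z)"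
proof -
  have S: "Suc 1 = 2" "Suc 2 = 3" "Suc 3 = 4" by simp_all
  note r = DERIV_theta_ratio(1)[OF assms, of 1, unfolded S theta_ratio_dlog]
    DERIV_theta_ratio(1)[OF assms, of 2, unfolded S theta_ratio_dlog(2,3)]
    DERIV_theta_ratio(1)[OF assms, of 3, unfolded S theta_ratio_dlog(3,4)]
  show 1: "((\<lambda>z. dlog1 z \<tau>) has_field_derivative 2 * of_real pi * \<i> * dlog2 z \<tau>) (at z)"
    by (rule DERIV_cong[OF r(1)]) (simp add: power2_eq_square)
  show 2: "((\<lambda>z. dlog2 z \<tau>) has_field_derivative 2 * of_real pi * \<i> * dlog3 z \<tau>) (at z)"
    using DERIV_diff[OF r(2) DERIV_power[OF 1, of 2]] 
    by (simp add: algebra_simps power2_eq_square power3_eq_cube)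
  have "((\<lambda>z. (dlog3 z \<tau> + 3 * dlog1 z \<tau> * dlog2 z \<tau> + dlog1 z \<tau> ^ 3) - 3 * dlog1 z \<tau> * dlog2 z \<tau> - dlog1 z \<tau> ^ 3)
     has_field_derivative 2 * of_real pi * \<i> * dlog4 z \<tau>) (at z)"
    by (rule derivative_eq_intros r(3) 1 2 refl)+ (simp, algebra)
  then show "((\<lambda>z. dlog3 z \<tau>) has_field_derivative 2 * of_real pi * \<i> * dlog4 z \<tau>) (at z)" by simp
qed

text \<open>The heat equation says D log theta = (d + s^2) / 2; the two formulas are its first and
  second derivatives in \<open>z\<close>.\<close>

lemma DERIV_dlog_tau:
  assumes "Im \<tau> > 0" "theta 0 z \<tau> \<noteq> 0"
  shows "(dlog1 z has_field_derivative 2 * of_real pi * \<i> * (dlog3 z \<tau> / 2 + dlog1 z \<tau> * dlog2 z \<tau>)) (at \<tau>)"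
    and "(dlog2 z has_field_derivative 2 * of_real pi * \<i> * (dlog4 z \<tau> / 2 + dlog2 z \<tau> ^ 2 + dlog1 z \<tau> * dlog3 z \<tau>)) (at \<tau>)"
proof -
  have S: "1 + 2 = (3::nat)" "2 + 2 = (4::nat)" by simp_all
  note r = DERIV_theta_ratio(2)[OF assms, of 1, unfolded S theta_ratio_dlog]
    DERIV_theta_ratio(2)[OF assms, of 2, unfolded S theta_ratio_dlog(2,4)]
  have "((\<lambda>\<tau>. dlog1 z \<tau>) has_field_derivative 2 * of_real pi * \<i> * (dlog3 z \<tau> / 2 + dlog1 z \<tau> * dlog2 z \<tau>)) (at \<tau>)"
    by (rule DERIV_cong[OF r(1)]) (simp add: power2_eq_square power3_eq_cube field_simps)
  then show 1: "(dlog1 z has_field_derivative 2 * of_real pi * \<i> * (dlog3 z \<tau> / 2 + dlog1 z \<tau> * dlog2 z \<tau>)) (at \<tau>)" .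
  have "((\<lambda>\<tau>. (dlog2 z \<tau> + dlog1 z \<tau> ^ 2) - dlog1 z \<tau> ^ 2) has_field_derivative
     2 * of_real pi * \<i> * (dlog4 z \<tau> / 2 + dlog2 z \<tau> ^ 2 + dlog1 z \<tau> * dlog3 z \<tau>)) (at \<tau>)"
    by (rule derivative_eq_intros r(2) 1 refl)+ (simp add: field_simps power2_eq_square power3_eq_cube power4_eq_xxxx)
  then show "(dlog2 z has_field_derivative 2 * of_real pi * \<i> * (dlog4 z \<tau> / 2 + dlog2 z \<tau> ^ 2 + dlog1 z \<tau> * dlog3 z \<tau>)) (at \<tau>)"
    by simp
qed

lemma theta_times_dlog:
  assumes "theta 0 z \<tau> \<noteq> 0"
  shows "theta 1 z \<tau> = theta 0 z \<tau> * dlog1 z \<tau>"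
    and "theta 2 z \<tau> = theta 0 z \<tau> * (dlog2 z \<tau> + dlog1 z \<tau> ^ 2)"
  using assms by (simp_all add: dlog1_def dlog2_def)

lemma dlog_addition:
  assumes "Im \<tau> > 0" "theta 0 u \<tau> \<noteq> 0" "theta 0 v \<tau> \<noteq> 0" "theta 0 (u + v) \<tau> \<noteq> 0"
  shows "(dlog1 u \<tau> + dlog1 v \<tau> - dlog1 (u + v) \<tau>) ^ 2 + dlog2 u \<tau> + dlog2 v \<tau> + dlog2 (u + v) \<tau> = theta 3 0 \<tau> / theta 1 0 \<tau>"
proof -
  define A B C where "A = theta 0 u \<tau>" and "B = theta 0 v \<tau>" and "C = theta 0 (u + v) \<tau>"
  have ABC: "A * B * C \<noteq> 0" using assms by (simp add: A_def B_def C_def)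
  have "v \<notin> period_lattice \<tau>" using assms by (simp add: theta_eq_0_iff)
  from theta_three_term[OF assms(1) this, of u]
  have "theta 1 0 \<tau> * ((dlog1 u \<tau> + dlog1 v \<tau> - dlog1 (u + v) \<tau>) ^ 2 + dlog2 u \<tau> + dlog2 v \<tau> + dlog2 (u + v) \<tau>) * (A * B * C)
      = theta 3 0 \<tau> * (A * B * C)"
    unfolding theta_times_dlog[OF assms(2)] theta_times_dlog[OF assms(3)] theta_times_dlog[OF assms(4)]
      A_def[symmetric] B_def[symmetric] C_def[symmetric] by algebra
  moreover have "theta 1 0 \<tau> \<noteq> 0" using assms by (simp add: theta_1_0 dedekind_eta_nonzero del: One_nat_def)
  ultimately show ?thesis using ABC by (metis mult_right_cancel nonzero_mult_div_cancel_left)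
qed

lemma DERIV_eq_0_of_locally_constant:
  fixes F :: "complex \<Rightarrow> complex"
  assumes "(F has_field_derivative D) (at z)" "open S" "z \<in> S" "\<And>w. w \<in> S \<Longrightarrow> F w = c"
  shows "D = 0"
  using has_field_derivative_transform_within_open[OF assms(1-3), of "\<lambda>_. c"] assms(4) DERIV_unique DERIV_const
  by metis

text \<open>With \<open>v\<close> fixed, the constant sum in \<open>dlog_addition\<close> is
  differentiated once and twice in \<open>u\<close>. At torsion points this expresses
  \<open>dlog3\<close> and \<open>dlog4\<close> through lower orders.\<close>

lemma dlog_addition_deriv:
  assumes \<tau>: "Im \<tau> > 0" and v: "theta 0 v \<tau> \<noteq> 0" and u: "theta 0 u \<tau> \<noteq> 0" "theta 0 (u + v) \<tau> \<noteq> 0"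
  shows "2 * (dlog1 u \<tau> + dlog1 v \<tau> - dlog1 (u + v) \<tau>) * (dlog2 u \<tau> - dlog2 (u + v) \<tau>) + dlog3 u \<tau> + dlog3 (u + v) \<tau> = 0"
    and "2 * (dlog2 u \<tau> - dlog2 (u + v) \<tau>) ^ 2 + 2 * (dlog1 u \<tau> + dlog1 v \<tau> - dlog1 (u + v) \<tau>) * (dlog3 u \<tau> - dlog3 (u + v) \<tau>)
       + dlog4 u \<tau> + dlog4 (u + v) \<tau> = 0"
proof -
  define W where "W = {u. theta 0 u \<tau> \<noteq> 0} \<inter> {u. theta 0 (u + v) \<tau> \<noteq> 0}"
  have cont: "continuous_on UNIV (\<lambda>u. theta 0 u \<tau>)" "continuous_on UNIV (\<lambda>u. theta 0 (u + v) \<tau>)"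
    using DERIV_theta_z[OF \<tau>, of 0] DERIV_theta_shift[OF \<tau>, of 0 v]
    by (auto intro!: continuous_at_imp_continuous_on DERIV_isCont)
  have W: "open W" unfolding W_def by (intro open_Int open_Collect_neq cont continuous_on_const)
  have d: "((\<lambda>u. dlog1 u \<tau>) has_field_derivative 2 * of_real pi * \<i> * dlog2 u \<tau>) (at u)"
    "((\<lambda>u. dlog2 u \<tau>) has_field_derivative 2 * of_real pi * \<i> * dlog3 u \<tau>) (at u)"
    "((\<lambda>u. dlog3 u \<tau>) has_field_derivative 2 * of_real pi * \<i> * dlog4 u \<tau>) (at u)"
    "((\<lambda>u. dlog1 (u + v) \<tau>) has_field_derivative 2 * of_real pi * \<i> * dlog2 (u + v) \<tau>) (at u)"
    "((\<lambda>u. dlog2 (u + v) \<tau>) has_field_derivative 2 * of_real pi * \<i> * dlog3 (u + v) \<tau>) (at u)"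
    "((\<lambda>u. dlog3 (u + v) \<tau>) has_field_derivative 2 * of_real pi * \<i> * dlog4 (u + v) \<tau>) (at u)"
    if "u \<in> W" for u
    using DERIV_dlog_z[OF \<tau>, of u] DERIV_dlog_z[OF \<tau>, of "u + v"] that
    unfolding DERIV_shift by (auto simp: W_def)
  have first: "2 * (dlog1 u \<tau> + dlog1 v \<tau> - dlog1 (u + v) \<tau>) * (dlog2 u \<tau> - dlog2 (u + v) \<tau>) + dlog3 u \<tau> + dlog3 (u + v) \<tau> = 0"
    if "u \<in> W" for u
  proof -
    have "((\<lambda>u. (dlog1 u \<tau> + dlog1 v \<tau> - dlog1 (u + v) \<tau>) ^ 2 + dlog2 u \<tau> + dlog2 v \<tau> + dlog2 (u + v) \<tau>) has_field_derivative
      2 * of_real pi * \<i> * (2 * (dlog1 u \<tau> + dlog1 v \<tau> - dlog1 (u + v) \<tau>) * (dlog2 u \<tau> - dlog2 (u + v) \<tau>) + dlog3 u \<tau> + dlog3 (u + v) \<tau>)) (at u)"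
      by (rule derivative_eq_intros d[OF that] refl)+ (simp add: algebra_simps)
    from DERIV_eq_0_of_locally_constant[OF this W that, of "theta 3 0 \<tau> / theta 1 0 \<tau>"]
    show ?thesis using dlog_addition[OF \<tau> _ v] by (simp add: W_def)
  qed
  have uW: "u \<in> W" using u by (simp add: W_def)
  show "2 * (dlog1 u \<tau> + dlog1 v \<tau> - dlog1 (u + v) \<tau>) * (dlog2 u \<tau> - dlog2 (u + v) \<tau>) + dlog3 u \<tau> + dlog3 (u + v) \<tau> = 0"
    by (rule first[OF uW])
  have "((\<lambda>u. 2 * (dlog1 u \<tau> + dlog1 v \<tau> - dlog1 (u + v) \<tau>) * (dlog2 u \<tau> - dlog2 (u + v) \<tau>) + dlog3 u \<tau> + dlog3 (u + v) \<tau>)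
     has_field_derivative 2 * of_real pi * \<i> * (2 * (dlog2 u \<tau> - dlog2 (u + v) \<tau>) ^ 2 + 2 * (dlog1 u \<tau> + dlog1 v \<tau> - dlog1 (u + v) \<tau>) * (dlog3 u \<tau> - dlog3 (u + v) \<tau>)
       + dlog4 u \<tau> + dlog4 (u + v) \<tau>)) (at u)"
    by (rule derivative_eq_intros d[OF uW] refl)+ (simp add: algebra_simps power2_eq_square)
  from DERIV_eq_0_of_locally_constant[OF this W uW first]
  show "2 * (dlog2 u \<tau> - dlog2 (u + v) \<tau>) ^ 2 + 2 * (dlog1 u \<tau> + dlog1 v \<tau> - dlog1 (u + v) \<tau>) * (dlog3 u \<tau> - dlog3 (u + v) \<tau>)
       + dlog4 u \<tau> + dlog4 (u + v) \<tau> = 0" by simp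
qed

lemma dlog_difference_product:
  assumes "Im \<tau> > 0" "2 * v \<notin> period_lattice \<tau>" "theta 0 u \<tau> \<noteq> 0" "theta 0 v \<tau> \<noteq> 0"
  shows "theta 1 0 \<tau> ^ 2 * (theta 0 (u + v) \<tau> * theta 0 (u - v) \<tau>) =
    theta 0 u \<tau> ^ 2 * theta 0 v \<tau> ^ 2 * (dlog2 u \<tau> - dlog2 v \<tau>)"
  unfolding theta_difference_product[OF assms(1,2)] theta_times_dlog[OF assms(3)] theta_times_dlog[OF assms(4)]
  by algebra

section \<open>Relations at the points of order 6\<close>

lemma real_in_period_lattice:
  assumes "Im \<tau> > 0" "of_real r \<in> period_lattice \<tau>"
  shows "\<exists>m::int. r = of_int m"
proof -
  obtain m n :: int where *: "of_real r = of_int m + of_int n * \<tau>" using assms(2) unfolding period_lattice_def by blast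
  from arg_cong[OF *, of Im] have "n = 0" using assms(1) by simp
  with arg_cong[OF *, of Re] show ?thesis by auto
qed

lemma theta_torsion_nonzero:
  assumes "Im \<tau> > 0"
  shows "theta 0 (1/6) \<tau> \<noteq> 0" "theta 0 (1/3) \<tau> \<noteq> 0" "theta 0 (1/2) \<tau> \<noteq> 0" "theta 0 (2/3) \<tau> \<noteq> 0"
proof -
  have *: "theta 0 (of_real r) \<tau> \<noteq> 0" if "0 < r" "r < 1" for r
  proof
    assume "theta 0 (of_real r) \<tau> = 0"
    then obtain m :: int where "r = of_int m"
      using real_in_period_lattice[OF assms] theta_eq_0_iff[OF assms] by blast
    with that show False by simp
  qed
  show "theta 0 (1/6) \<tau> \<noteq> 0" "theta 0 (1/3) \<tau> \<noteq> 0" "theta 0 (1/2) \<tau> \<noteq> 0" "theta 0 (2/3) \<tau> \<noteq> 0"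
    using *[of "1/6"] *[of "1/3"] *[of "1/2"] *[of "2/3"] by simp_all
qed

lemma theta_one_minus:
  assumes "Im \<tau> > 0"
  shows "theta k (1 - z) \<tau> = (-1) ^ k * theta k z \<tau>"
  using theta_plus_1[of k "- z" \<tau>] theta_minus[OF assms, of k z] by simp

lemma dlog_one_minus:
  assumes "Im \<tau> > 0"
  shows "dlog1 (1 - z) \<tau> = - dlog1 z \<tau>" "dlog2 (1 - z) \<tau> = dlog2 z \<tau>"
    "dlog3 (1 - z) \<tau> = - dlog3 z \<tau>" "dlog4 (1 - z) \<tau> = dlog4 z \<tau>"
proof -
  show 1: "dlog1 (1 - z) \<tau> = - dlog1 z \<tau>" by (simp add: dlog1_def theta_one_minus[OF assms])
  show 2: "dlog2 (1 - z) \<tau> = dlog2 z \<tau>" by (simp add: dlog2_def 1 theta_one_minus[OF assms])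
  show 3: "dlog3 (1 - z) \<tau> = - dlog3 z \<tau>" by (simp add: dlog3_def 1 2 theta_one_minus[OF assms])
  show "dlog4 (1 - z) \<tau> = dlog4 z \<tau>" by (simp add: dlog4_def 1 2 3 theta_one_minus[OF assms])
qed

text \<open>The addition theorem at (1/3, 1/3) determines the inhomogeneous constant; at (1/6, 1/6)
  and (1/6, 1/3) it can then be solved for \<open>dlog2\<close> at 1/6 and 1/2. The third and fourth
  orders come from the differentiated theorem, with odd orders zero at 1/2 and reflected from 2/3 to
  1/3.\<close>

lemma dlog_torsion:
  assumes \<tau>: "Im \<tau> > 0"
  shows "9 * dlog1 (1/3) \<tau> ^ 2 + 3 * dlog2 (1/3) \<tau> = theta 3 0 \<tau> / theta 1 0 \<tau>"
    and "dlog2 (1/2) \<tau> - dlog2 (1/3) \<tau> = (dlog1 (1/6) \<tau> - 2 * dlog1 (1/3) \<tau>) ^ 2"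
    and "dlog2 (1/2) \<tau> - dlog2 (1/6) \<tau> = 3 * dlog1 (1/6) \<tau> * (dlog1 (1/6) \<tau> - 2 * dlog1 (1/3) \<tau>)"
    and "dlog3 (1/6) \<tau> = - 2 * (dlog1 (1/6) \<tau> + dlog1 (1/3) \<tau>) * (dlog2 (1/6) \<tau> - dlog2 (1/2) \<tau>)"
    and "dlog3 (1/3) \<tau> = - 2 * (dlog1 (1/6) \<tau> + dlog1 (1/3) \<tau>) * (dlog2 (1/3) \<tau> - dlog2 (1/2) \<tau>)"
    and "dlog4 (1/3) \<tau> = - 6 * dlog1 (1/3) \<tau> * dlog3 (1/3) \<tau>"
proof -
  note nz = theta_torsion_nonzero[OF \<tau>]
  have e: "1/3 + 1/3 = (2/3 :: complex)" "1/6 + 1/6 = (1/3 :: complex)" "1/6 + 1/3 = (1/2 :: complex)" "1/3 + 1/6 = (1/2 :: complex)"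
    by simp_all
  have h: "dlog1 (1/2) \<tau> = 0" "dlog3 (1/2) \<tau> = 0"
    using dlog_one_minus[OF \<tau>, of "1/2"] by simp_all
  have t: "dlog1 (2/3) \<tau> = - dlog1 (1/3) \<tau>" "dlog2 (2/3) \<tau> = dlog2 (1/3) \<tau>" "dlog3 (2/3) \<tau> = - dlog3 (1/3) \<tau>" "dlog4 (2/3) \<tau> = dlog4 (1/3) \<tau>"
    using dlog_one_minus[OF \<tau>, of "1/3"] by simp_all
  have A: "(dlog1 (1/3) \<tau> + dlog1 (1/3) \<tau> + dlog1 (1/3) \<tau>) ^ 2 + dlog2 (1/3) \<tau> + dlog2 (1/3) \<tau> + dlog2 (1/3) \<tau> = theta 3 0 \<tau> / theta 1 0 \<tau>"
    using dlog_addition[OF \<tau>, of "1/3" "1/3", unfolded e t] nz by simp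
  then show A': "9 * dlog1 (1/3) \<tau> ^ 2 + 3 * dlog2 (1/3) \<tau> = theta 3 0 \<tau> / theta 1 0 \<tau>" by algebra
  have B: "(dlog1 (1/6) \<tau> + dlog1 (1/6) \<tau> - dlog1 (1/3) \<tau>) ^ 2 + dlog2 (1/6) \<tau> + dlog2 (1/6) \<tau> + dlog2 (1/3) \<tau> = theta 3 0 \<tau> / theta 1 0 \<tau>"
    using dlog_addition[OF \<tau>, of "1/6" "1/6", unfolded e] nz by simp
  have C: "(dlog1 (1/6) \<tau> + dlog1 (1/3) \<tau>) ^ 2 + dlog2 (1/6) \<tau> + dlog2 (1/3) \<tau> + dlog2 (1/2) \<tau> = theta 3 0 \<tau> / theta 1 0 \<tau>"
    using dlog_addition[OF \<tau>, of "1/6" "1/3", unfolded e h] nz by simp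
  have B2: "2 * dlog2 (1/6) \<tau> = 9 * dlog1 (1/3) \<tau> ^ 2 + 2 * dlog2 (1/3) \<tau> - (2 * dlog1 (1/6) \<tau> - dlog1 (1/3) \<tau>) ^ 2"
    using B A' by algebra
  have C2: "dlog2 (1/2) \<tau> = 9 * dlog1 (1/3) \<tau> ^ 2 + 2 * dlog2 (1/3) \<tau> - dlog2 (1/6) \<tau> - (dlog1 (1/6) \<tau> + dlog1 (1/3) \<tau>) ^ 2"
    using C A' by algebra
  have "2 * (dlog2 (1/2) \<tau> - dlog2 (1/3) \<tau>) = 2 * (dlog1 (1/6) \<tau> - 2 * dlog1 (1/3) \<tau>) ^ 2" using B2 C2 by algebra
  then show "dlog2 (1/2) \<tau> - dlog2 (1/3) \<tau> = (dlog1 (1/6) \<tau> - 2 * dlog1 (1/3) \<tau>) ^ 2"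
    by (simp only: mult_cancel_left) simp
  show "dlog2 (1/2) \<tau> - dlog2 (1/6) \<tau> = 3 * dlog1 (1/6) \<tau> * (dlog1 (1/6) \<tau> - 2 * dlog1 (1/3) \<tau>)"
    using B2 C2 by algebra
  show "dlog3 (1/6) \<tau> = - 2 * (dlog1 (1/6) \<tau> + dlog1 (1/3) \<tau>) * (dlog2 (1/6) \<tau> - dlog2 (1/2) \<tau>)"
    using dlog_addition_deriv(1)[OF \<tau>, of "1/3" "1/6", unfolded e h] nz by simp algebra
  show "dlog3 (1/3) \<tau> = - 2 * (dlog1 (1/6) \<tau> + dlog1 (1/3) \<tau>) * (dlog2 (1/3) \<tau> - dlog2 (1/2) \<tau>)"
    using dlog_addition_deriv(1)[OF \<tau>, of "1/6" "1/3", unfolded e h] nz by simp algebra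
  have "2 * (dlog2 (1/3) \<tau> - dlog2 (1/3) \<tau>) ^ 2 + 2 * (dlog1 (1/3) \<tau> + dlog1 (1/3) \<tau> - - dlog1 (1/3) \<tau>) * (dlog3 (1/3) \<tau> - - dlog3 (1/3) \<tau>)
       + dlog4 (1/3) \<tau> + dlog4 (1/3) \<tau> = 0"
    using dlog_addition_deriv(2)[OF \<tau>, of "1/3" "1/3", unfolded e t] nz by blast
  then have "2 * (dlog4 (1/3) \<tau> + 6 * dlog1 (1/3) \<tau> * dlog3 (1/3) \<tau>) = 0" by (simp add: algebra_simps)
  then have "dlog4 (1/3) \<tau> + 6 * dlog1 (1/3) \<tau> * dlog3 (1/3) \<tau> = 0" by (simp only: mult_eq_0_iff) simp
  then show "dlog4 (1/3) \<tau> = - 6 * dlog1 (1/3) \<tau> * dlog3 (1/3) \<tau>"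
    by (simp add: eq_neg_iff_add_eq_0)
qed

text \<open>A square root of \<open>dlog2 (1/2) \<tau> - dlog2 (1/3) \<tau>\<close>, used as unit of
  weight one: \<open>dlog1\<close>, differences of \<open>dlog2\<close>, \<open>dlog3\<close> and
  \<open>dlog4 (1/3)\<close> become polynomials in the eta quotient times its first, second, third
  and fourth power.\<close>

definition hauptmodul_scale :: "complex \<Rightarrow> complex" where
  "hauptmodul_scale \<tau> = dlog1 (1/6) \<tau> - 2 * dlog1 (1/3) \<tau>"

text \<open>Dividing \<open>P1\<close> by \<open>P2\<close> gives b^4 / a^4 = 3 s(1/6) / g, and this
  ratio equals 9 f by the eta product. \<open>P3\<close> shows that s(1/6) + s(1/3) = (9 f - 1) g /
  2 is nonzero, which excludes f = 1/9.\<close>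

lemma eta_quotient_dlog:
  assumes \<tau>: "Im \<tau> > 0"
  shows "hauptmodul_scale \<tau> \<noteq> 0" "eta_quotient \<tau> \<noteq> 0" "9 * eta_quotient \<tau> \<noteq> 1"
    and "dlog1 (1/6) \<tau> = 3 * eta_quotient \<tau> * hauptmodul_scale \<tau>"
    and "dlog1 (1/3) \<tau> = (3 * eta_quotient \<tau> - 1) / 2 * hauptmodul_scale \<tau>"
proof -
  define a b h t where "a = theta 0 (1/6) \<tau>" and "b = theta 0 (1/3) \<tau>" and "h = theta 0 (1/2) \<tau>" and "t = theta 1 0 \<tau>"
  define g where "g = hauptmodul_scale \<tau>"
  define f where "f = eta_quotient \<tau>"
  note nz = theta_torsion_nonzero[OF \<tau>]
  have abh: "a \<noteq> 0" "b \<noteq> 0" "h \<noteq> 0" using nz by (simp_all add: a_def b_def h_def)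
  have t: "t \<noteq> 0" using \<tau> by (simp add: t_def theta_1_0 dedekind_eta_nonzero del: One_nat_def)
  have lat: "2 * (1/6) \<notin> period_lattice \<tau>" "2 * (1/3) \<notin> period_lattice \<tau>"
    using nz by (simp_all add: theta_eq_0_iff[OF \<tau>])
  have e: "1/2 + 1/6 = (2/3 :: complex)" "1/2 - 1/6 = (1/3 :: complex)" "1/2 + 1/3 = (5/6 :: complex)" "1/2 - 1/3 = (1/6 :: complex)"
    "1/3 + 1/6 = (1/2 :: complex)" "1/3 - 1/6 = (1/6 :: complex)" by simp_all
  have r: "theta 0 (2/3) \<tau> = b" "theta 0 (5/6) \<tau> = a"
    using theta_one_minus[OF \<tau>, of 0 "1/3"] theta_one_minus[OF \<tau>, of 0 "1/6"] by (simp_all add: a_def b_def)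
  have P1: "t ^ 2 * (b * b) = h ^ 2 * a ^ 2 * (3 * dlog1 (1/6) \<tau> * g)"
    using dlog_difference_product[OF \<tau> lat(1) nz(3) nz(1), unfolded e r dlog_torsion(3)[OF \<tau>]]
    by (simp only: a_def b_def h_def t_def g_def hauptmodul_scale_def)
  have P2: "t ^ 2 * (a * a) = h ^ 2 * b ^ 2 * g ^ 2"
    using dlog_difference_product[OF \<tau> lat(2) nz(3) nz(2), unfolded e r dlog_torsion(2)[OF \<tau>]]
    by (simp only: a_def b_def h_def t_def g_def hauptmodul_scale_def)
  have P3: "t ^ 2 * (h * a) = b ^ 2 * a ^ 2 * (dlog2 (1/3) \<tau> - dlog2 (1/6) \<tau>)"
    using dlog_difference_product[OF \<tau> lat(1) nz(2) nz(1), unfolded e]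
    by (simp only: a_def b_def h_def t_def)
  have d: "dlog2 (1/3) \<tau> - dlog2 (1/6) \<tau> = 2 * g * (dlog1 (1/6) \<tau> + dlog1 (1/3) \<tau>)"
    using dlog_torsion(2,3)[OF \<tau>] unfolding g_def hauptmodul_scale_def by algebra
  have F: "b ^ 4 = 9 * f * a ^ 4" using eta_quotient_theta[OF \<tau>] by (simp add: a_def b_def f_def)
  show g: "hauptmodul_scale \<tau> \<noteq> 0" using P2 abh t by (auto simp: g_def)
  show f: "eta_quotient \<tau> \<noteq> 0" using F abh by (auto simp: f_def)
  have "(h ^ 2 * a ^ 4 * b ^ 2 * 3 * g) * dlog1 (1/6) \<tau> = (h ^ 2 * a ^ 4 * b ^ 2 * 3 * g) * (3 * f * g)"
    using P1 P2 F by algebra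
  then show s1: "dlog1 (1/6) \<tau> = 3 * eta_quotient \<tau> * hauptmodul_scale \<tau>"
    using abh g by (simp add: f_def g_def)
  then show s2: "dlog1 (1/3) \<tau> = (3 * eta_quotient \<tau> - 1) / 2 * hauptmodul_scale \<tau>"
    by (simp add: hauptmodul_scale_def field_simps)
  have "dlog1 (1/6) \<tau> + dlog1 (1/3) \<tau> \<noteq> 0" using P3 d abh t by auto
  moreover have "2 * (dlog1 (1/6) \<tau> + dlog1 (1/3) \<tau>) = (9 * eta_quotient \<tau> - 1) * hauptmodul_scale \<tau>"
    unfolding s2 by (subst s1) (simp add: field_simps)
  ultimately show "9 * eta_quotient \<tau> \<noteq> 1"
    by (metis cancel_comm_monoid_add_class.diff_cancel mult_eq_0_iff zero_neq_numeral)
qed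

section \<open>Derivatives in the period and the differential equation\<close>

text \<open>The first bracket is deliberately split into D log g, the factor appearing in the second
  formula, and a remainder. In the quotient \<open>dlog1 (1/6)\<close> by g, which is 3 f, the part
  containing d cancels and the remainder is D log f.\<close>

lemma DERIV_theta_torsion:
  assumes \<tau>: "Im \<tau> > 0"
  defines "f \<equiv> eta_quotient \<tau>" and "g \<equiv> hauptmodul_scale \<tau>" and "d \<equiv> dlog2 (1/3) \<tau>"
  shows "(dlog1 (1/6) has_field_derivative 2 * of_real pi * \<i> * (3 * f * g * (d + (9 * f - 1) * (3 * f - 2) / 2 * g ^ 2 + - 3 / 2 * (f - 1) * (9 * f - 1) * g ^ 2))) (at \<tau>)"
    and "(hauptmodul_scale has_field_derivative 2 * of_real pi * \<i> * (g * (d + (9 * f - 1) * (3 * f - 2) / 2 * g ^ 2))) (at \<tau>)"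
    and "(dlog2 (1/3) has_field_derivative 2 * of_real pi * \<i> * (d ^ 2 - (3 * f - 1) * (9 * f - 1) * g ^ 4)) (at \<tau>)"
proof -
  define s1 s2 d1 d3 where "s1 = dlog1 (1/6) \<tau>" and "s2 = dlog1 (1/3) \<tau>" and "d1 = dlog2 (1/6) \<tau>" and "d3 = dlog2 (1/2) \<tau>"
  note nz = theta_torsion_nonzero[OF \<tau>]
  have s: "s1 = 3 * f * g" "2 * s2 = (3 * f - 1) * g"
    using eta_quotient_dlog(4,5)[OF \<tau>] by (simp_all add: s1_def s2_def f_def g_def mult_ac)
  have dd: "d3 - d = g ^ 2" "d3 - d1 = 3 * s1 * g"
    using dlog_torsion(2,3)[OF \<tau>] by (simp_all add: s1_def s2_def d1_def d3_def d_def g_def hauptmodul_scale_def)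
  have d1: "d1 = d + g ^ 2 - 9 * f * g ^ 2" using dd s by algebra
  have d3: "d3 = d + g ^ 2" using dd by algebra
  have ss: "s1 + s2 = (9 * f - 1) * g / 2" using s by (simp add: field_simps)
  have e1: "dlog3 (1/6) \<tau> = (9 * f - 1) * g * (9 * f * g ^ 2)"
    using dlog_torsion(4)[OF \<tau>] unfolding s1_def[symmetric] s2_def[symmetric] d1_def[symmetric] d3_def[symmetric] ss
    by (simp add: d1 d3)
  have e2: "dlog3 (1/3) \<tau> = (9 * f - 1) * g * g ^ 2"
    using dlog_torsion(5)[OF \<tau>] unfolding s1_def[symmetric] s2_def[symmetric] d_def[symmetric] d3_def[symmetric] ss
    by (simp add: d3)
  have g2: "dlog4 (1/3) \<tau> = - 3 * ((3 * f - 1) * g) * ((9 * f - 1) * g * g ^ 2)"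
    using dlog_torsion(6)[OF \<tau>] s(2) unfolding e2 s2_def[symmetric] by algebra
  have s2: "s2 = (3 * f - 1) * g / 2" using s(2) by (simp add: field_simps)
  have D1: "(dlog1 (1/6) has_field_derivative 2 * of_real pi * \<i> * ((9 * f - 1) * g * (9 * f * g ^ 2) / 2 + s1 * d1)) (at \<tau>)"
    using DERIV_dlog_tau(1)[OF \<tau> nz(1)] unfolding e1 s1_def d1_def .
  have D2: "(dlog1 (1/3) has_field_derivative 2 * of_real pi * \<i> * ((9 * f - 1) * g * g ^ 2 / 2 + s2 * d)) (at \<tau>)"
    using DERIV_dlog_tau(1)[OF \<tau> nz(2)] unfolding e2 s2_def d_def .
  show "(dlog1 (1/6) has_field_derivative 2 * of_real pi * \<i> * (3 * f * g * (d + (9 * f - 1) * (3 * f - 2) / 2 * g ^ 2 + - 3 / 2 * (f - 1) * (9 * f - 1) * g ^ 2))) (at \<tau>)"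
    by (rule DERIV_cong[OF D1]) (simp add: s d1 field_simps power2_eq_square)
  have "((\<lambda>\<tau>. dlog1 (1/6) \<tau> - 2 * dlog1 (1/3) \<tau>) has_field_derivative 2 * of_real pi * \<i> * (g * (d + (9 * f - 1) * (3 * f - 2) / 2 * g ^ 2))) (at \<tau>)"
    by (rule DERIV_cong[OF DERIV_diff[OF D1 DERIV_cmult[OF D2]]]) (simp add: s s2 d1 field_simps power2_eq_square)
  then show "(hauptmodul_scale has_field_derivative 2 * of_real pi * \<i> * (g * (d + (9 * f - 1) * (3 * f - 2) / 2 * g ^ 2))) (at \<tau>)"
    by (simp add: hauptmodul_scale_def[abs_def])
  show "(dlog2 (1/3) has_field_derivative 2 * of_real pi * \<i> * (d ^ 2 - (3 * f - 1) * (9 * f - 1) * g ^ 4)) (at \<tau>)"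
    using DERIV_dlog_tau(2)[OF \<tau> nz(2)] unfolding e2 g2 s2_def[symmetric] d_def[symmetric] s2
    by (rule DERIV_cong) (simp add: field_simps power2_eq_square power4_eq_xxxx)
qed

lemma open_upper_half: "open {\<tau>. Im \<tau> > 0}"
  by (simp add: open_halfspace_Im_gt)

lemma DERIV_eta_quotient:
  assumes \<tau>: "Im \<tau> > 0"
  defines "f \<equiv> eta_quotient \<tau>" and "g \<equiv> hauptmodul_scale \<tau>"
  shows "(eta_quotient has_field_derivative 2 * of_real pi * \<i> * (- 3 / 2 * f * (f - 1) * (9 * f - 1) * g ^ 2)) (at \<tau>)"
proof -
  define d where "d = dlog2 (1/3) \<tau>"
  have g: "g \<noteq> 0" using eta_quotient_dlog(1)[OF \<tau>] by (simp add: g_def)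
  have s: "dlog1 (1/6) \<tau> = 3 * f * g" using eta_quotient_dlog(4)[OF \<tau>] by (simp add: f_def g_def)
  define c where "c = 2 * of_real pi * \<i>"
  define p where "p = d + (9 * f - 1) * (3 * f - 2) / 2 * g ^ 2"
  define r where "r = - 3 / 2 * (f - 1) * (9 * f - 1) * g ^ 2"
  have "((\<lambda>\<tau>. dlog1 (1/6) \<tau> / hauptmodul_scale \<tau>) has_field_derivative
      (c * (3 * f * g * (p + r)) * g - 3 * f * g * (c * (g * p))) / (g * g)) (at \<tau>)"
    using DERIV_divide[OF DERIV_theta_torsion(1,2)[OF \<tau>] eta_quotient_dlog(1)[OF \<tau>]] s
    by (simp only: f_def[symmetric] g_def[symmetric] d_def[symmetric] c_def p_def r_def)
  then have "((\<lambda>\<tau>. dlog1 (1/6) \<tau> / hauptmodul_scale \<tau>) has_field_derivative 3 * (c * (f * r))) (at \<tau>)"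
    by (rule DERIV_cong) (use g in \<open>simp add: field_simps\<close>)
  then have "((\<lambda>\<tau>. dlog1 (1/6) \<tau> / hauptmodul_scale \<tau> / 3) has_field_derivative 3 * (c * (f * r)) / 3) (at \<tau>)"
    by (rule DERIV_cdivide)
  then have "(eta_quotient has_field_derivative 3 * (c * (f * r)) / 3) (at \<tau>)"
  proof (rule has_field_derivative_transform_within_open[OF _ open_upper_half])
    show "dlog1 (1/6) w / hauptmodul_scale w / 3 = eta_quotient w" if "w \<in> {\<tau>. Im \<tau> > 0}" for w
      using that eta_quotient_dlog(1,4)[of w] by simp
  qed (use \<tau> in simp)
  then show ?thesis by (rule DERIV_cong) (simp add: c_def r_def)
qed

text \<open>Because D c = c d(1/3) and D f is g^2 times a polynomial in f, this quotient is the
  logarithmic derivative of c with respect to f, up to a rational function of f.\<close>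

definition riccati :: "complex \<Rightarrow> complex" where
  "riccati \<tau> = dlog2 (1/3) \<tau> / hauptmodul_scale \<tau> ^ 2"

lemma DERIV_riccati:
  assumes \<tau>: "Im \<tau> > 0"
  defines "f \<equiv> eta_quotient \<tau>" and "g \<equiv> hauptmodul_scale \<tau>" and "Z \<equiv> riccati \<tau>"
  shows "(riccati has_field_derivative 2 * of_real pi * \<i> *
    (- (g ^ 2) * (Z ^ 2 + (9 * f - 1) * (3 * f - 2) * Z + (3 * f - 1) * (9 * f - 1)))) (at \<tau>)"
proof -
  define d where "d = dlog2 (1/3) \<tau>"
  have g: "g \<noteq> 0" using eta_quotient_dlog(1)[OF \<tau>] by (simp add: g_def)
  have Z: "d = Z * g ^ 2" using g by (simp add: Z_def riccati_def d_def g_def)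
  define c where "c = 2 * of_real pi * \<i>"
  define A B where "A = (9 * f - 1) * (3 * f - 2)" and "B = (3 * f - 1) * (9 * f - 1)"
  have "((\<lambda>\<tau>. dlog2 (1/3) \<tau> / hauptmodul_scale \<tau> ^ 2) has_field_derivative
     (c * (d ^ 2 - B * g ^ 4) * g ^ 2 - d * (2 * (c * (g * (d + A / 2 * g ^ 2))) * g)) / (g ^ 2 * g ^ 2)) (at \<tau>)"
    using DERIV_divide[OF DERIV_theta_torsion(3)[OF \<tau>] DERIV_power[OF DERIV_theta_torsion(2)[OF \<tau>], of 2]] g
    by (simp add: f_def[symmetric] g_def[symmetric] d_def[symmetric] c_def A_def B_def mult_ac)
  then have "(riccati has_field_derivative
     (c * (d ^ 2 - B * g ^ 4) * g ^ 2 - d * (2 * (c * (g * (d + A / 2 * g ^ 2))) * g)) / (g ^ 2 * g ^ 2)) (at \<tau>)"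
    by (simp add: riccati_def[abs_def])
  then show ?thesis
    unfolding A_def[symmetric] B_def[symmetric] c_def[symmetric]
    by (rule DERIV_cong) (use g in \<open>simp add: Z field_simps power2_eq_square power4_eq_xxxx\<close>)
qed

text \<open>Differentiability comes from \<open>theta_third\<close> at \<open>\<tau> / 3\<close>,
  the value of the derivative from eta^3 being a multiple of \<open>theta 1 0 \<tau>\<close>
  together with the heat equation. The cube alone would leave a choice of cube root.\<close>

lemma DERIV_dedekind_eta:
  assumes \<tau>: "Im \<tau> > 0"
  shows "(dedekind_eta has_field_derivative 2 * of_real pi * \<i> * (dedekind_eta \<tau> * (theta 3 0 \<tau> / theta 1 0 \<tau> / 6))) (at \<tau>)"
proof -
  have eta: "dedekind_eta w = - theta 0 (1/3) (w / 3) / of_real (sqrt 3)" if "Im w > 0" for w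
    using theta_third[of "w / 3"] that by simp
  have "((\<lambda>w. theta 0 (1/3) (w / 3)) has_field_derivative of_real pi * \<i> * theta (0 + 2) (1/3) (\<tau> / 3) * (1 / 3)) (at \<tau>)"
    by (rule DERIV_chain2[OF DERIV_theta_tau]) (use \<tau> in \<open>auto intro!: derivative_eq_intros\<close>)
  then have "((\<lambda>w. - theta 0 (1/3) (w / 3) / of_real (sqrt 3)) has_field_derivative
      - (of_real pi * \<i> * theta (0 + 2) (1/3) (\<tau> / 3) * (1 / 3)) / of_real (sqrt 3)) (at \<tau>)"
    by (intro DERIV_cdivide DERIV_minus)
  then obtain D where D: "(dedekind_eta has_field_derivative D) (at \<tau>)"
    using has_field_derivative_transform_within_open[OF _ open_upper_half, of "\<lambda>w. - theta 0 (1/3) (w / 3) / of_real (sqrt 3)" _ \<tau> dedekind_eta]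
      eta \<tau> by force
  have nz: "dedekind_eta \<tau> \<noteq> 0" by (rule dedekind_eta_nonzero[OF \<tau>])
  have "((\<lambda>w. \<i> * dedekind_eta w ^ 3) has_field_derivative \<i> * (3 * D * dedekind_eta \<tau> ^ 2)) (at \<tau>)"
    using DERIV_cmult[OF DERIV_power[OF D, of 3], of \<i>] by (simp add: mult_ac)
  then have "((\<lambda>w. theta 1 0 w) has_field_derivative \<i> * (3 * D * dedekind_eta \<tau> ^ 2)) (at \<tau>)"
    by (rule has_field_derivative_transform_within_open[OF _ open_upper_half]) (use \<tau> theta_1_0 in auto)
  moreover have "((\<lambda>w. theta 1 0 w) has_field_derivative of_real pi * \<i> * theta (1 + 2) 0 \<tau>) (at \<tau>)"
    by (rule DERIV_theta_tau[OF \<tau>])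
  ultimately have "\<i> * (3 * D * dedekind_eta \<tau> ^ 2) = of_real pi * \<i> * theta (1 + 2) 0 \<tau>"
    by (rule DERIV_unique)
  then have "\<i> * (3 * D * dedekind_eta \<tau> ^ 2) = of_real pi * \<i> * theta 3 0 \<tau>" by (simp add: numeral_3_eq_3)
  then have "D = 2 * of_real pi * \<i> * (dedekind_eta \<tau> * (theta 3 0 \<tau> / theta 1 0 \<tau> / 6))"
    unfolding theta_1_0[OF \<tau>] using nz by (simp add: field_simps power2_eq_square power3_eq_cube)
  with D show ?thesis by simp
qed

text \<open>D log c = 3 (d + s^2) / 2 - T / 6, and T = 9 s^2 + 3 d removes s^2 and leaves d.\<close>

lemma DERIV_cubic_theta_c:
  assumes \<tau>: "Im \<tau> > 0"
  shows "(cubic_theta_c has_field_derivative 2 * of_real pi * \<i> * (cubic_theta_c \<tau> * dlog2 (1/3) \<tau>)) (at \<tau>)"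
proof -
  define k :: complex where "k = - 3 / of_real (sqrt 3) ^ 3"
  define b where "b = theta 0 (1/3) \<tau>"
  define E where "E = dedekind_eta \<tau>"
  define T where "T = theta 3 0 \<tau> / theta 1 0 \<tau>"
  define s d where "s = dlog1 (1/3) \<tau>" and "d = dlog2 (1/3) \<tau>"
  have c: "cubic_theta_c w = k * theta 0 (1/3) w ^ 3 / dedekind_eta w" if "Im w > 0" for w
  proof -
    have "dedekind_eta (3 * w) = - theta 0 (1/3) w / of_real (sqrt 3)" using theta_third[OF that] by simp
    moreover have "cubic_theta_c w = 3 * dedekind_eta (3 * w) ^ 3 / dedekind_eta w"
      using cubic_theta_c_eta[OF that] dedekind_eta_nonzero[OF that] by (simp add: eq_divide_eq)
    ultimately show ?thesis by (simp add: k_def power_divide)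
  qed
  have E: "E \<noteq> 0" using dedekind_eta_nonzero[OF \<tau>] by (simp add: E_def)
  have b: "theta 2 (1/3) \<tau> = b * (d + s ^ 2)"
    using theta_times_dlog(2)[OF theta_torsion_nonzero(2)[OF \<tau>]] by (simp add: b_def d_def s_def)
  have T: "T = 9 * s ^ 2 + 3 * d" using dlog_torsion(1)[OF \<tau>] by (simp add: T_def s_def d_def)
  have "(theta 0 (1/3) has_field_derivative of_real pi * \<i> * (b * (d + s ^ 2))) (at \<tau>)"
    using DERIV_theta_tau[OF \<tau>, of 0 "1/3"] by (simp only: add_0_left b)
  from DERIV_divide[OF DERIV_cmult[OF DERIV_power[OF this, of 3], of k] DERIV_dedekind_eta[OF \<tau>] dedekind_eta_nonzero[OF \<tau>]]
  have "((\<lambda>w. k * theta 0 (1/3) w ^ 3 / dedekind_eta w) has_field_derivative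
      (k * (3 * (of_real pi * \<i> * (b * (d + s ^ 2)) * b ^ 2)) * E - k * b ^ 3 * (2 * of_real pi * \<i> * (E * (T / 6)))) / (E * E)) (at \<tau>)"
    by (simp add: b_def[symmetric] E_def[symmetric] T_def[symmetric] del: One_nat_def)
  then have "(cubic_theta_c has_field_derivative
      (k * (3 * (of_real pi * \<i> * (b * (d + s ^ 2)) * b ^ 2)) * E - k * b ^ 3 * (2 * of_real pi * \<i> * (E * (T / 6)))) / (E * E)) (at \<tau>)"
    by (rule has_field_derivative_transform_within_open[OF _ open_upper_half]) (use \<tau> c in auto)
  then show ?thesis
    by (rule DERIV_cong) (use E in \<open>simp add: c[OF \<tau>] T d_def[symmetric] b_def[symmetric] E_def[symmetric] field_simps power2_eq_square power3_eq_cube\<close>)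
qed

theorem theorem8p11:
  fixes V :: "complex set" and T l :: "complex \<Rightarrow> complex"
  assumes "local_holomorphic_inverse eta_quotient upper_half_plane V T"
    and "\<forall>f\<in>V. l f = cubic_theta_c (T f)"
  shows "l holomorphic_on V \<and>
    (\<forall>f\<in>V. f \<noteq> 0 \<and> f \<noteq> 1 \<and> f \<noteq> 1/9 \<and>
       deriv (deriv l) f
       + (- ((1/3) / f) + (1/3) / (f - 1) + 1 / (f - 1/9)) * deriv l f
       + (4 * (f - 1/3)) / (27 * f\<^sup>2 * (f - 1)\<^sup>2 * (f - 1/9)) * l f = 0)"
proof -
  have V: "open V" and T: "T holomorphic_on V" and im: "\<And>w. w \<in> V \<Longrightarrow> Im (T w) > 0"
    and inv: "\<And>w. w \<in> V \<Longrightarrow> eta_quotient (T w) = w"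
    using assms(1) by (auto simp: local_holomorphic_inverse_def upper_half_plane_def)
  define c where "c = 2 * of_real pi * \<i>"
  define g where "g w = hauptmodul_scale (T w)" for w
  define Z where "Z w = riccati (T w)" for w
  \<comment> \<open>By \<open>chain\<close> this is c g^2 dT/dw. Hence the derivative in
    \<open>w\<close> of any F(T w) is (D F / g^2) R, free of explicit derivatives of
    \<open>T\<close>.\<close>
  define R where "R w = - 2 / (3 * w * (w - 1) * (9 * w - 1))" for w :: complex
  have g: "g w \<noteq> 0" if "w \<in> V" for w using eta_quotient_dlog(1)[OF im[OF that]] by (simp add: g_def)
  have dT: "(T has_field_derivative deriv T w) (at w)" if "w \<in> V" for w
    using T V that by (rule holomorphic_derivI)
  have chain: "c * (- 3 / 2 * w * (w - 1) * (9 * w - 1) * g w ^ 2) * deriv T w = 1" if "w \<in> V" for w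
  proof -
    have "((\<lambda>w. eta_quotient (T w)) has_field_derivative c * (- 3 / 2 * w * (w - 1) * (9 * w - 1) * g w ^ 2) * deriv T w) (at w)"
      using DERIV_chain2[OF DERIV_eta_quotient[OF im[OF that]] dT[OF that]] unfolding inv[OF that]
      by (simp only: c_def g_def)
    then have "((\<lambda>w. w) has_field_derivative c * (- 3 / 2 * w * (w - 1) * (9 * w - 1) * g w ^ 2) * deriv T w) (at w)"
      by (rule has_field_derivative_transform_within_open[OF _ V that]) (simp add: inv)
    then show ?thesis using DERIV_ident by (rule DERIV_unique)
  qed
  \<comment> \<open>A right inverse exists only where the derivative of \<open>f\<close> does not vanish, which excludes \<open>f = 1\<close>.\<close>
  have nz: "w \<noteq> 0" "w - 1 \<noteq> 0" "9 * w - 1 \<noteq> 0" if "w \<in> V" for w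
    using chain[OF that] by auto
  have T': "c * (g w ^ 2 * deriv T w) = R w" if "w \<in> V" for w
  proof -
    have "c * (g w ^ 2 * deriv T w) * (3 * w * (w - 1) * (9 * w - 1))
        = - 2 * (c * (- 3 / 2 * w * (w - 1) * (9 * w - 1) * g w ^ 2) * deriv T w)"
      by (simp add: mult_ac)
    then show ?thesis using nz[OF that] unfolding chain[OF that] R_def by (subst eq_divide_eq) auto
  qed
  have l: "(l has_field_derivative l w * Z w * R w) (at w)" if "w \<in> V" for w
  proof -
    have "((\<lambda>w. cubic_theta_c (T w)) has_field_derivative
        c * (cubic_theta_c (T w) * dlog2 (1/3) (T w)) * deriv T w) (at w)"
      unfolding c_def by (rule DERIV_chain2[OF DERIV_cubic_theta_c[OF im[OF that]] dT[OF that]])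
    moreover have "dlog2 (1/3) (T w) = Z w * g w ^ 2"
      using g[OF that] by (simp add: Z_def riccati_def g_def)
    ultimately have "((\<lambda>w. cubic_theta_c (T w)) has_field_derivative l w * Z w * R w) (at w)"
      using assms(2) that by (simp flip: T'[OF that] add: mult_ac)
    then show ?thesis
      by (rule has_field_derivative_transform_within_open[OF _ V that]) (use assms(2) in simp)
  qed
  have Z: "(Z has_field_derivative - (Z w ^ 2 + (9 * w - 1) * (3 * w - 2) * Z w + (3 * w - 1) * (9 * w - 1)) * R w) (at w)"
    if "w \<in> V" for w
  proof -
    have "((\<lambda>w. riccati (T w)) has_field_derivative c *
      (- (g w ^ 2) * (Z w ^ 2 + (9 * w - 1) * (3 * w - 2) * Z w + (3 * w - 1) * (9 * w - 1))) * deriv T w) (at w)"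
      using DERIV_chain2[OF DERIV_riccati[OF im[OF that]] dT[OF that]] unfolding inv[OF that]
      by (simp only: c_def g_def Z_def)
    then have "((\<lambda>w. riccati (T w)) has_field_derivative
      - (Z w ^ 2 + (9 * w - 1) * (3 * w - 2) * Z w + (3 * w - 1) * (9 * w - 1)) * R w) (at w)"
      by (rule DERIV_cong) (unfold T'[OF that, symmetric], algebra)
    then show ?thesis by (simp add: Z_def[abs_def])
  qed
  have R: "(R has_field_derivative R w * (- 1 / w - 1 / (w - 1) - 9 / (9 * w - 1))) (at w)" if "w \<in> V" for w
  proof -
    have "((\<lambda>w. - 2 / (3 * w * (w - 1) * (9 * w - 1))) has_field_derivative
       R w * (- 1 / w - 1 / (w - 1) - 9 / (9 * w - 1))) (at w)"
      using nz[OF that] by (auto intro!: derivative_eq_intros simp: R_def divide_simps) algebra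
    then show ?thesis by (simp add: R_def[abs_def])
  qed
  \<comment> \<open>The \<open>Z w ^ 2\<close> coming from l' = l Z R cancels the one in the Riccati
    equation. What remains is linear in \<open>Z\<close>, and so in \<open>l\<close> and its
    derivative.\<close>
  have l2: "deriv (deriv l) w = l w * R w *
      (R w * (- ((9 * w - 1) * (3 * w - 2) * Z w + (3 * w - 1) * (9 * w - 1)))
        + Z w * (- 1 / w - 1 / (w - 1) - 9 / (9 * w - 1)))" if "w \<in> V" for w
  proof -
    have "((\<lambda>w. l w * Z w * R w) has_field_derivative
       (l w * Z w * R w * Z w + - (Z w ^ 2 + (9 * w - 1) * (3 * w - 2) * Z w + (3 * w - 1) * (9 * w - 1)) * R w * l w) * R w
       + R w * (- 1 / w - 1 / (w - 1) - 9 / (9 * w - 1)) * (l w * Z w)) (at w)"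
      by (rule DERIV_mult[OF DERIV_mult[OF l[OF that] Z[OF that]] R[OF that]])
    then have "(deriv l has_field_derivative
       (l w * Z w * R w * Z w + - (Z w ^ 2 + (9 * w - 1) * (3 * w - 2) * Z w + (3 * w - 1) * (9 * w - 1)) * R w * l w) * R w
       + R w * (- 1 / w - 1 / (w - 1) - 9 / (9 * w - 1)) * (l w * Z w)) (at w)"
      by (rule has_field_derivative_transform_within_open[OF _ V that]) (simp add: DERIV_imp_deriv[OF l])
    then have "deriv (deriv l) w = (l w * Z w * R w * Z w + - (Z w ^ 2 + (9 * w - 1) * (3 * w - 2) * Z w + (3 * w - 1) * (9 * w - 1)) * R w * l w) * R w
       + R w * (- 1 / w - 1 / (w - 1) - 9 / (9 * w - 1)) * (l w * Z w)"
      by (rule DERIV_imp_deriv)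
    then show ?thesis by algebra
  qed
  have "l holomorphic_on V"
    using l V by (auto simp: holomorphic_on_open)
  moreover have "w \<noteq> 0 \<and> w \<noteq> 1 \<and> w \<noteq> 1/9 \<and>
       deriv (deriv l) w
       + (- ((1/3) / w) + (1/3) / (w - 1) + 1 / (w - 1/9)) * deriv l w
       + (4 * (w - 1/3)) / (27 * w\<^sup>2 * (w - 1)\<^sup>2 * (w - 1/9)) * l w = 0" if "w \<in> V" for w
  proof -
    note nz = nz[OF that]
    define P where "P = - ((1/3) / w) + (1/3) / (w - 1) + 1 / (w - 1/9)"
    define Q where "Q = (4 * (w - 1/3)) / (27 * w\<^sup>2 * (w - 1)\<^sup>2 * (w - 1/9))"
    have n9: "w - 1/9 = (9 * w - 1) / 9" by simp
    have n3: "w - 1/3 = (3 * w - 1) / 3" by simp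
    \<comment> \<open>Comparison with \<open>l2\<close>: the coefficient of l Z R has to be - P, the
      one of l has to be - Q.\<close>
    have "R w * (- ((9 * w - 1) * (3 * w - 2))) + (- 1 / w - 1 / (w - 1) - 9 / (9 * w - 1)) + P = 0"
      unfolding P_def R_def n9 using nz by (simp add: divide_simps) algebra
    moreover have "R w * R w * (- ((3 * w - 1) * (9 * w - 1))) + Q = 0"
      unfolding Q_def R_def n9 n3 using nz by (simp add: divide_simps) algebra
    ultimately have "deriv (deriv l) w + P * (l w * Z w * R w) + Q * l w = 0"
      unfolding l2[OF that] by algebra
    moreover have "w \<noteq> 1/9" using nz(3) by (auto simp: eq_divide_eq mult.commute)
    ultimately show ?thesis using nz DERIV_imp_deriv[OF l[OF that]] by (simp add: P_def Q_def)
  qed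
  ultimately show ?thesis by blast
qed

end
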